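(* Let $W$ be a $d\times d$ matrix weight on $\mathbb{R}$, and let $\{A_I\}_{I\in\mathcal{D}}$ be a sequence of $d\times d$ positive definite matrices. For $J\in\mathcal{D}$ put $$\widetilde{\mathbf M}_J=\frac{1}{|J|}\sum_{K\in\mathcal{D},\,K\subsetneq J}\langle W\rangle_K A_K\langle W\rangle_K .$$ If $$\frac{1}{|I|}\sum_{J\in\mathcal{D},\,J\subseteq I}\langle W\rangle_J A_J\langle W\rangle_J\le\langle W\rangle_I\quad\text{for all } I\in\mathcal{D},$$ then for every $0<t\le1$ and every $f\in L^2(\mathbb{R})$ (with values in $\mathbb{C}^d$), $$t\sum_{I\in\mathcal{D}}\Big\langle \big(I_d+t\langle W\rangle_I^{-1}\widetilde{\mathbf M}_I\big)^{-1}A_I\big(I_d+t\,\widetilde{\mathbf M}_I\langle W\rangle_I^{-1}\big)^{-1}\langle W^{1/2}f\rangle_I,\ \langle W^{1/2}f\rangle_I\Big\rangle_{\mathbb{C}^d}\le 8\,\|f\|^2_{L^2(\mathbb{R})}.$$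
   Context: $\mathcal{D}$ is a dyadic system of intervals on $\mathbb{R}$: with $\mathcal{D}^0_j=\{2^{-j}([0,1)+k):k\in\mathbb{Z}\}$ and $\omega\in\{0,1\}^{\mathbb{Z}}$, a dyadic system is $\mathcal{D}^\omega=\bigcup_{j\in\mathbb{Z}}\mathcal{D}^\omega_j$, $\mathcal{D}^\omega_j=\mathcal{D}^0_j+\sum_{i>j}2^{-i}\omega_i$. A matrix weight is a measurable, locally integrable function $W:\mathbb{R}\to\mathcal{M}_d(\mathbb{C})$ whose values are a.e. positive definite. $\langle F\rangle_I=|I|^{-1}\int_I F(t)\,dt$. $L^2(\mathbb{R})$ is the unweighted space of measurable $f:\mathbb{R}\to\mathbb{C}^d$ with $\|f\|^2_{L^2(\mathbb{R})}=\int_{\mathbb{R}}\|f(t)\|^2_{\mathbb{C}^d}\,dt<\infty$. $I_d$ is the $d\times d$ identity matrix, and $\le$ between Hermitian matrices is the Loewner (positive semidefinite) order. *)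

theory Defs
  imports "HOL-Analysis.Analysis" "HOL-Library.Complex_Order"
begin

section \<open>Complex matrices\<close>

text \<open>
  The inner product that HOL-Analysis provides on \<open>complex ^ 'd\<close> is the real one; the
  sesquilinear one, linear in the first argument, has to be introduced.  Its induced norm is the
  library norm of \<open>complex ^ 'd\<close>.
\<close>

definition cdot :: "complex ^ 'd \<Rightarrow> complex ^ 'd \<Rightarrow> complex" where
  "cdot x y = (\<Sum>i\<in>UNIV. x $ i * cnj (y $ i))"

definition hermitian :: "complex ^ 'd ^ 'd \<Rightarrow> bool" where
  "hermitian A \<longleftrightarrow> (\<forall>i j. A $ i $ j = cnj (A $ j $ i))"

text \<open>
  Inequalities between complex numbers are those of \<^theory>\<open>HOL-Library.Complex_Order\<close>:
  \<open>z \<le> w\<close> means \<open>Re z \<le> Re w\<close> and \<open>Im z = Im w\<close>.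
\<close>

definition pos_semidef :: "complex ^ 'd ^ 'd \<Rightarrow> bool" where
  "pos_semidef A \<longleftrightarrow> hermitian A \<and> (\<forall>x. 0 \<le> cdot (A *v x) x)"

definition pos_def :: "complex ^ 'd ^ 'd \<Rightarrow> bool" where
  "pos_def A \<longleftrightarrow> hermitian A \<and> (\<forall>x. x \<noteq> 0 \<longrightarrow> 0 < cdot (A *v x) x)"

text \<open>
  The order \<open>\<le>\<close> that the library puts on vectors is componentwise, so it must not be used for
  matrices.
\<close>

definition loewner_le :: "complex ^ 'd ^ 'd \<Rightarrow> complex ^ 'd ^ 'd \<Rightarrow> bool" where
  "loewner_le A B \<longleftrightarrow> pos_semidef (B - A)"

definition matrix_sqrt :: "complex ^ 'd ^ 'd \<Rightarrow> complex ^ 'd ^ 'd" where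
  "matrix_sqrt A = (THE B. pos_semidef B \<and> B ** B = A)"

section \<open>Dyadic systems\<close>

definition std_dyadic :: "int \<Rightarrow> real set set" where
  "std_dyadic j = {(\<lambda>x. 2 powi (- j) * (x + of_int k)) ` {0..<1} |k :: int. True}"

definition dyadic_shift :: "(int \<Rightarrow> nat) \<Rightarrow> int \<Rightarrow> real" where
  "dyadic_shift \<omega> j = (\<Sum>\<^sub>\<infinity>i\<in>{j<..}. 2 powi (- i) * real (\<omega> i))"

definition dyadic_level :: "(int \<Rightarrow> nat) \<Rightarrow> int \<Rightarrow> real set set" where
  "dyadic_level \<omega> j = (\<lambda>I. (\<lambda>x. x + dyadic_shift \<omega> j) ` I) ` std_dyadic j"

definition dyadic_of :: "(int \<Rightarrow> nat) \<Rightarrow> real set set" where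
  "dyadic_of \<omega> = (\<Union>j. dyadic_level \<omega> j)"

definition dyadic_system :: "real set set \<Rightarrow> bool" where
  "dyadic_system D \<longleftrightarrow> (\<exists>\<omega>. range \<omega> \<subseteq> {0, 1} \<and> D = dyadic_of \<omega>)"

section \<open>Averages, matrix weights and square-integrable functions\<close>

definition average ::
    "(real \<Rightarrow> 'a) \<Rightarrow> real set \<Rightarrow> 'a::{banach, second_countable_topology}" where
  "average F I = (1 / measure lebesgue I) *\<^sub>R (LINT t:I|lebesgue. F t)"

definition locally_integrable ::
    "(real \<Rightarrow> 'a::{banach, second_countable_topology}) \<Rightarrow> bool" where
  "locally_integrable F \<longleftrightarrow> (\<forall>K. compact K \<longrightarrow> set_integrable lebesgue K F)"

definition matrix_weight :: "(real \<Rightarrow> complex ^ 'd ^ 'd) \<Rightarrow> bool" where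
  "matrix_weight W \<longleftrightarrow>
     W \<in> borel_measurable lebesgue \<and> locally_integrable W \<and> (AE t in lebesgue. pos_def (W t))"

definition in_L2 :: "(real \<Rightarrow> complex ^ 'd) \<Rightarrow> bool" where
  "in_L2 f \<longleftrightarrow>
     f \<in> borel_measurable lebesgue \<and> integrable lebesgue (\<lambda>t. (norm (f t))\<^sup>2)"

definition L2_norm :: "(real \<Rightarrow> complex ^ 'd) \<Rightarrow> real" where
  "L2_norm f = sqrt (LINT t|lebesgue. (norm (f t))\<^sup>2)"

section \<open>Sums over dyadic intervals\<close>

definition carleson_term ::
    "(real \<Rightarrow> complex ^ 'd ^ 'd) \<Rightarrow> (real set \<Rightarrow> complex ^ 'd ^ 'd) \<Rightarrow> real set
      \<Rightarrow> complex ^ 'd ^ 'd" where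
  "carleson_term W A K = average W K ** A K ** average W K"

text \<open>
  A non-convergent \<open>infsum\<close> is \<open>0\<close> by convention.  Since the terms are positive semidefinite, an
  upper bound for the sum in the sense of the Loewner order includes its convergence, which is
  therefore part of the condition.
\<close>

definition carleson_condition ::
    "real set set \<Rightarrow> (real \<Rightarrow> complex ^ 'd ^ 'd) \<Rightarrow> (real set \<Rightarrow> complex ^ 'd ^ 'd)
      \<Rightarrow> bool" where
  "carleson_condition D W A \<longleftrightarrow>
     (\<forall>I\<in>D. carleson_term W A summable_on {J \<in> D. J \<subseteq> I} \<and>
       loewner_le
         ((1 / measure lebesgue I) *\<^sub>R (\<Sum>\<^sub>\<infinity>J\<in>{J \<in> D. J \<subseteq> I}. carleson_term W A J))
         (average W I))"

definition M_tilde ::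
    "real set set \<Rightarrow> (real \<Rightarrow> complex ^ 'd ^ 'd) \<Rightarrow> (real set \<Rightarrow> complex ^ 'd ^ 'd)
      \<Rightarrow> real set \<Rightarrow> complex ^ 'd ^ 'd" where
  "M_tilde D W A J =
     (1 / measure lebesgue J) *\<^sub>R (\<Sum>\<^sub>\<infinity>K\<in>{K \<in> D. K \<subset> J}. carleson_term W A K)"

definition embedding_term ::
    "real set set \<Rightarrow> (real \<Rightarrow> complex ^ 'd ^ 'd) \<Rightarrow> (real set \<Rightarrow> complex ^ 'd ^ 'd)
      \<Rightarrow> real \<Rightarrow> (real \<Rightarrow> complex ^ 'd) \<Rightarrow> real set \<Rightarrow> complex" where
  "embedding_term D W A t f I =
     (let V = average W I; M = M_tilde D W A I; v = average (\<lambda>s. matrix_sqrt (W s) *v f s) I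
      in cdot ((matrix_inv (mat 1 + t *\<^sub>R (matrix_inv V ** M)) ** A I
                ** matrix_inv (mat 1 + t *\<^sub>R (M ** matrix_inv V))) *v v) v)"

end

theory Submission
  imports Defs
begin

text \<open>
  The proof is a Bellman function argument.  On a dyadic interval \<open>I\<close> let \<open>V\<close> be the average of
  \<open>W\<close>, \<open>x\<close> the average of \<open>W\<^sup>1\<^sup>/\<^sup>2 f\<close>, and \<open>M\<close> the normalised sum of the Carleson terms over all
  dyadic \<open>J \<subseteq> I\<close>, so that \<open>M = M_tilde + V A V / |I|\<close>.  Put
  \<open>b I = x\<^sup>* (V + t M)\<^sup>-\<^sup>1 x\<close>.  Everything follows from the inequality
  \<open>t e I + 2 |I| b I \<le> 2 |L| b L + 2 |R| b R\<close> for the halves \<open>L\<close>, \<open>R\<close> of \<open>I\<close>, in which \<open>e I\<close> is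
  the embedding term.

  The inequality has two sources.  The function \<open>(x, P) \<mapsto> x\<^sup>* P\<^sup>-\<^sup>1 x\<close> is jointly convex and
  decreasing in \<open>P\<close>, and \<open>V\<close>, \<open>x\<close> and (up to an inequality in the right direction) \<open>M_tilde\<close> on \<open>I\<close>
  are the means of \<open>V\<close>, \<open>x\<close> and \<open>M\<close> over the two halves; so
  \<open>|I| x\<^sup>* (V + t M_tilde)\<^sup>-\<^sup>1 x\<close> is at most \<open>|L| b L + |R| b R\<close> (\<open>bellman_halves\<close>).  Replacing
  \<open>M_tilde\<close> by \<open>M\<close> adds \<open>Q = t V A V / |I|\<close> to \<open>P = V + t M_tilde\<close>.  By the Carleson condition and
  \<open>t \<le> 1\<close> one has \<open>Q \<le> P\<close>, and then the form of the inverse drops by at least half of its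
  first-order variation (\<open>inverse_form_drop\<close>), which is \<open>t e I / |I|\<close> because
  \<open>(I + t V\<^sup>-\<^sup>1 M_tilde)\<^sup>-\<^sup>1 = P\<^sup>-\<^sup>1 V\<close> (\<open>resolvent_form\<close>).

  Summing over levels, the values of \<open>b\<close> telescope.  Those of the finest level are controlled by
  \<open>|I| b I \<le> \<integral>\<^sub>I |f|\<^sup>2\<close> (\<open>bellman_le\<close>), and these intervals are disjoint.  Hence every finite
  partial sum of \<open>t e I\<close> is at most \<open>2 \<parallel>f\<parallel>\<^sup>2\<close>, which is better than the constant \<open>8\<close>.

  Both convexity and the last bound are read off from
  \<open>x\<^sup>* P\<^sup>-\<^sup>1 x = max\<^sub>y (2 Re \<langle>x, y\<rangle> - \<langle>P y, y\<rangle>)\<close> (\<open>inverse_form_ge\<close>).  The bound also uses that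
  \<open>matrix_sqrt\<close> really is a square root, that is, existence and uniqueness of the positive
  semidefinite square root; these are derived from an eigenvector that maximises the Rayleigh
  quotient.
\<close>

section \<open>Hermitian matrices through the real inner product\<close>

text \<open>
  The real part of the sesquilinear inner product is the real inner product on
  \<open>complex ^ 'd\<close>.  As the quadratic form of a Hermitian matrix is real, Hermitian symmetry,
  positivity and the Loewner order can all be expressed by the real inner product, for which the
  calculus of \<open>euclidean_space\<close> is available.
\<close>

lemma Re_cdot: "Re (cdot x y) = x \<bullet> y"
  by (simp add: cdot_def inner_vec_def inner_complex_def)

lemma cdot_hermitian_swap:
  assumes "hermitian M"
  shows "cdot (M *v x) y = cdot x (M *v y)"
proof -
  have "cdot (M *v x) y = (\<Sum>i\<in>UNIV. \<Sum>j\<in>UNIV. M $ i $ j * x $ j * cnj (y $ i))"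
    by (simp add: cdot_def matrix_vector_mult_def sum_distrib_right)
  also have "\<dots> = (\<Sum>j\<in>UNIV. \<Sum>i\<in>UNIV. M $ i $ j * x $ j * cnj (y $ i))"
    by (rule sum.swap)
  also have "\<dots> = (\<Sum>j\<in>UNIV. \<Sum>i\<in>UNIV. x $ j * cnj (M $ j $ i * y $ i))"
  proof (intro sum.cong refl)
    fix i j :: 'a
    have "M $ i $ j = cnj (M $ j $ i)"
      using assms unfolding hermitian_def by blast
    then show "M $ i $ j * x $ j * cnj (y $ i) = x $ j * cnj (M $ j $ i * y $ i)"
      by simp
  qed
  also have "\<dots> = cdot x (M *v y)"
    by (simp add: cdot_def matrix_vector_mult_def sum_distrib_left)
  finally show ?thesis .
qed

lemma cdot_commute: "cdot x y = cnj (cdot y x)"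
  by (simp add: cdot_def mult.commute)

lemma matrix_vector_mult_axis: "(M *v axis j a) $ i = M $ i $ j * (a :: complex)"
  by (simp add: matrix_vector_mult_def axis_def if_distrib cong: if_cong)

text \<open>
  Symmetry for the real inner product alone forces Hermitian symmetry: testing on the vectors
  \<open>axis j 1\<close>, \<open>axis i 1\<close> gives the real parts of the entries, and testing on \<open>axis j 1\<close>,
  \<open>axis i \<i>\<close> the imaginary parts.
\<close>

lemma hermitian_iff_inner:
  "hermitian M \<longleftrightarrow> (\<forall>x y. (M *v x) \<bullet> y = x \<bullet> (M *v y))"
proof
  assume "hermitian M"
  then show "\<forall>x y. (M *v x) \<bullet> y = x \<bullet> (M *v y)"
    by (metis Re_cdot cdot_hermitian_swap)
next
  assume sym: "\<forall>x y. (M *v x) \<bullet> y = x \<bullet> (M *v y)"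
  have "(M $ i $ j * a) \<bullet> b = a \<bullet> (M $ j $ i * b)" for i j a b
    using sym[rule_format, of "axis j a" "axis i b"]
    by (simp add: inner_axis inner_axis' matrix_vector_mult_axis)
  note entry = this
  have "Re (M $ i $ j) = Re (M $ j $ i)" for i j
    by (rule entry[of i j 1 1, unfolded inner_complex_def, simplified])
  moreover have "Im (M $ i $ j) = - Im (M $ j $ i)" for i j
    by (rule entry[of i j 1 \<i>, unfolded inner_complex_def, simplified])
  ultimately show "hermitian M"
    unfolding hermitian_def complex_eq_iff cnj.simps by blast
qed

lemma cdot_hermitian:
  assumes "hermitian M"
  shows "cdot (M *v x) x = complex_of_real ((M *v x) \<bullet> x)"
proof -
  have "cdot (M *v x) x = cnj (cdot (M *v x) x)"
    using cdot_hermitian_swap[OF assms, of x x] cdot_commute[of x "M *v x"] by simp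
  then have "Im (cdot (M *v x) x) = 0"
    by (metis complex_cnj_cancel_iff cnj.simps(2) neg_equal_zero)
  then show ?thesis
    by (simp add: complex_eq_iff Re_cdot)
qed

lemma pos_semidef_iff_inner:
  "pos_semidef M \<longleftrightarrow> hermitian M \<and> (\<forall>x. 0 \<le> (M *v x) \<bullet> x)"
  by (auto simp: pos_semidef_def cdot_hermitian less_eq_complex_def)

lemma pos_def_iff_inner:
  "pos_def M \<longleftrightarrow> hermitian M \<and> (\<forall>x. x \<noteq> 0 \<longrightarrow> 0 < (M *v x) \<bullet> x)"
  by (auto simp: pos_def_def cdot_hermitian less_complex_def)

lemma pos_def_imp_pos_semidef: "pos_def M \<Longrightarrow> pos_semidef M"
  unfolding pos_def_iff_inner pos_semidef_iff_inner
proof (elim conjE, intro conjI allI)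
  fix x
  assume "\<forall>x. x \<noteq> 0 \<longrightarrow> 0 < (M *v x) \<bullet> x"
  then show "0 \<le> (M *v x) \<bullet> x"
    by (cases "x = 0") (auto simp: less_imp_le)
qed

lemma scaleR_matrix_vector: "(r *\<^sub>R M) *v x = r *\<^sub>R (M *v (x :: complex ^ 'n))"
  by (simp add: matrix_vector_mult_def vec_eq_iff scaleR_sum_right)

lemma matrix_vector_scaleR: "M *v (r *\<^sub>R x) = r *\<^sub>R (M *v (x :: complex ^ 'n))"
  by (simp add: matrix_vector_mult_def vec_eq_iff scaleR_sum_right)

lemma matrix_add_mult: "(K + L) ** N = K ** N + L ** (N :: complex ^ 'n ^ 'n)"
  by (simp add: matrix_eq matrix_vector_mult_add_rdistrib flip: matrix_vector_mul_assoc)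

lemma matrix_scaleR_mult:
  fixes K L :: "complex ^ 'n ^ 'n"
  shows "K ** (c *\<^sub>R L) = c *\<^sub>R (K ** L)" "(c *\<^sub>R K) ** L = c *\<^sub>R (K ** L)"
  by (simp_all add: matrix_eq scaleR_matrix_vector matrix_vector_scaleR
      flip: matrix_vector_mul_assoc)

lemma loewner_le_iff_inner:
  "loewner_le M N \<longleftrightarrow> hermitian (N - M) \<and> (\<forall>x. (M *v x) \<bullet> x \<le> (N *v x) \<bullet> x)"
  by (simp add: loewner_le_def pos_semidef_iff_inner matrix_vector_mult_diff_rdistrib
      inner_diff_left)

lemma hermitian_add: "hermitian M \<Longrightarrow> hermitian N \<Longrightarrow> hermitian (M + N)"
  by (simp add: hermitian_iff_inner matrix_vector_mult_add_rdistrib inner_add_left inner_add_right)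

lemma hermitian_diff: "hermitian M \<Longrightarrow> hermitian N \<Longrightarrow> hermitian (M - N)"
  by (simp add: hermitian_iff_inner matrix_vector_mult_diff_rdistrib inner_diff_left
      inner_diff_right)

lemma hermitian_scaleR: "hermitian M \<Longrightarrow> hermitian (r *\<^sub>R M)"
  by (simp add: hermitian_iff_inner scaleR_matrix_vector)

lemma hermitian_mat: "hermitian (mat 1)"
  by (simp add: hermitian_iff_inner)

text \<open>
  If \<open>w = M v\<close> were nonzero, then the form at \<open>v - s w\<close>, which is
  \<open>- 2 s |w|\<^sup>2\<close> up to a term quadratic in \<open>s\<close>, would be negative for small \<open>s > 0\<close>.
\<close>

lemma pos_semidef_null:
  assumes "pos_semidef M" "(M *v v) \<bullet> v = 0"
  shows "M *v v = 0"
proof (rule ccontr)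
  define w where "w = M *v v"
  define c where "c = (M *v w) \<bullet> w"
  \<comment> \<open>adding \<open>1\<close> keeps the denominator positive if \<open>c = 0\<close>\<close>
  define s where "s = (w \<bullet> w) / (c + 1)"
  assume "M *v v \<noteq> 0"
  then have w: "w \<bullet> w > 0"
    by (simp add: w_def)
  have c: "c \<ge> 0"
    using assms by (simp add: pos_semidef_iff_inner c_def)
  have sym: "(M *v w) \<bullet> v = w \<bullet> w"
    using assms by (auto simp: pos_semidef_iff_inner hermitian_iff_inner w_def)
  have "0 \<le> (M *v (v - s *\<^sub>R w)) \<bullet> (v - s *\<^sub>R w)"
    using assms by (simp add: pos_semidef_iff_inner)
  also have "\<dots> = - 2 * s * (w \<bullet> w) + s * s * c"
    using assms(2) sym
    by (simp add: matrix_vector_mult_diff_distrib matrix_vector_scaleR inner_diff_left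
        inner_diff_right c_def algebra_simps flip: w_def)
  also have "\<dots> = s * (s * c - 2 * (w \<bullet> w))"
    by (simp add: algebra_simps)
  finally have "s * (s * c - 2 * (w \<bullet> w)) \<ge> 0" .
  moreover have "s > 0"
    using w c by (simp add: s_def)
  ultimately have "s * c \<ge> 2 * (w \<bullet> w)"
    by (simp add: zero_le_mult_iff)
  moreover have "s * (c + 1) = w \<bullet> w"
    using c by (simp add: s_def)
  ultimately show False
    using w \<open>s > 0\<close> by (simp add: algebra_simps)
qed

lemma invertible_if_pos_def:
  assumes "pos_def M"
  shows "invertible M"
proof -
  have "x = 0" if "M *v x = 0" for x
    using assms that unfolding pos_def_iff_inner by (metis inner_zero_left less_irrefl)
  then obtain N where "N ** M = mat 1"
    using matrix_left_invertible_ker[of M] by blast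
  then show ?thesis
    by (metis invertible_def matrix_left_right_inverse)
qed

lemma matrix_inv_mult:
  assumes "invertible M"
  shows "matrix_inv M ** M = mat 1" "M ** matrix_inv M = mat 1"
  using someI_ex[OF assms[unfolded invertible_def]] by (auto simp: matrix_inv_def)

lemma matrix_inv_eqI:
  fixes M N :: "complex ^ 'n ^ 'n"
  assumes "M ** N = mat 1"
  shows "matrix_inv M = N"
proof -
  have "N ** M = mat 1"
    using assms matrix_left_right_inverse by blast
  then have "invertible M"
    using assms invertible_def by blast
  then show ?thesis
    by (metis assms matrix_inv_mult(1) matrix_mul_assoc matrix_mul_lid matrix_mul_rid)
qed

section \<open>The square root of a positive semidefinite matrix\<close>

text \<open>
  A maximiser \<open>v\<close> of the Rayleigh quotient on the unit sphere is an eigenvector: with \<open>r\<close> the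
  maximum, \<open>r I - M\<close> is positive semidefinite and its form vanishes at \<open>v\<close>.
\<close>

lemma ex_max_eigenvector:
  assumes M: "pos_semidef M" and "M \<noteq> 0"
  shows "\<exists>v r. norm v = 1 \<and> 0 < r \<and> M *v v = r *\<^sub>R v"
proof -
  let ?S = "sphere (0 :: complex ^ 'a) 1"
  have "?S \<noteq> {}"
    by simp
  moreover have "continuous_on ?S (\<lambda>x. (M *v x) \<bullet> x)"
    by (intro continuous_intros linear_continuous_on matrix_vector_mul_bounded_linear)
  ultimately obtain v where v: "v \<in> ?S" and
    max: "\<And>x. x \<in> ?S \<Longrightarrow> (M *v x) \<bullet> x \<le> (M *v v) \<bullet> v"
    using continuous_attains_sup[of ?S] compact_sphere by blast
  define r where "r = (M *v v) \<bullet> v"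
  define G where "G = r *\<^sub>R mat 1 - M"
  have G: "G *v x = r *\<^sub>R x - M *v x" for x
    by (simp add: G_def matrix_vector_mult_diff_rdistrib scaleR_matrix_vector)
  have le: "(M *v x) \<bullet> x \<le> r * (x \<bullet> x)" for x
  proof (cases "x = 0")
    case False
    define u where "u = (1 / norm x) *\<^sub>R x"
    have x: "x = norm x *\<^sub>R u"
      using False by (simp add: u_def)
    have "(M *v u) \<bullet> u \<le> r"
      unfolding r_def using False by (intro max) (simp add: u_def)
    then have "norm x * norm x * ((M *v u) \<bullet> u) \<le> norm x * norm x * r"
      by (intro mult_left_mono) auto
    moreover have "(M *v x) \<bullet> x = norm x * norm x * ((M *v u) \<bullet> u)"
      by (subst (1 2) x) (simp add: matrix_vector_scaleR)
    ultimately show ?thesis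
      by (simp add: dot_square_norm power2_eq_square mult.commute)
  qed simp
  have herm: "hermitian M"
    using M by (simp add: pos_semidef_iff_inner)
  have "pos_semidef G"
    unfolding pos_semidef_iff_inner
  proof
    show "hermitian G"
      unfolding G_def by (intro hermitian_diff hermitian_scaleR hermitian_mat herm)
  qed (simp add: G inner_diff_left le)
  moreover have "(G *v v) \<bullet> v = 0"
    using v by (simp add: G inner_diff_left r_def dot_square_norm)
  ultimately have "M *v v = r *\<^sub>R v"
    using pos_semidef_null[of G v] G by simp
  moreover have "r > 0"
  proof (rule ccontr)
    assume "\<not> r > 0"
    have "(M *v x) \<bullet> x = 0" for x
    proof (rule antisym)
      show "0 \<le> (M *v x) \<bullet> x"
        using M by (simp add: pos_semidef_iff_inner)
      have "r * (x \<bullet> x) \<le> 0"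
        using \<open>\<not> r > 0\<close> by (intro mult_nonpos_nonneg) auto
      then show "(M *v x) \<bullet> x \<le> 0"
        using le[of x] by linarith
    qed
    then have "M *v x = 0" for x
      using pos_semidef_null M by blast
    then show False
      using \<open>M \<noteq> 0\<close> by (metis matrix_eq matrix_vector_mult_0)
  qed
  ultimately show ?thesis
    using v by auto
qed

definition rank_one :: "complex ^ 'd \<Rightarrow> complex ^ 'd ^ 'd" where
  "rank_one v = (\<chi> i j. v $ i * cnj (v $ j))"

lemma cdot_scale: "cdot (c *s x) y = c * cdot x y"
  by (simp add: cdot_def sum_distrib_left mult.assoc)

lemma rank_one_mult_vector: "rank_one v *v x = cdot x v *s v"
  by (simp add: rank_one_def matrix_vector_mult_def vec_eq_iff cdot_def sum_distrib_right
      sum_distrib_left mult_ac)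

lemma hermitian_rank_one: "hermitian (rank_one v)"
  by (simp add: hermitian_def rank_one_def)

lemma mult_rank_one:
  assumes "M *v v = 0"
  shows "M ** rank_one v = 0"
proof -
  have "(M ** rank_one v) $ i $ j = (M *v v) $ i * cnj (v $ j)" for i j
    by (simp add: matrix_matrix_mult_def rank_one_def matrix_vector_mult_def sum_distrib_right
        mult.assoc)
  then show ?thesis
    by (simp add: assms vec_eq_iff)
qed

lemma rank_one_mult:
  assumes "hermitian M" "M *v v = 0"
  shows "rank_one v ** M = 0"
proof -
  have "rank_one v *v (M *v x) = 0" for x
    using assms cdot_hermitian_swap[OF assms(1), of x v]
    by (simp add: rank_one_mult_vector cdot_def)
  then show ?thesis
    by (simp add: matrix_eq matrix_vector_mul_assoc)
qed

lemma cdot_self: "cdot x x = complex_of_real ((norm x)\<^sup>2)"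
  using cdot_hermitian[OF hermitian_mat, of x] by (simp add: dot_square_norm)

lemma rank_one_idem: "norm v = 1 \<Longrightarrow> rank_one v ** rank_one v = rank_one v"
  by (simp add: matrix_eq rank_one_mult_vector cdot_self flip: matrix_vector_mul_assoc)
     (simp add: cdot_scale cdot_self)

text \<open>
  Removing the spectral component of a unit eigenvector \<open>v\<close> keeps the matrix positive: since \<open>N\<close>
  kills \<open>v\<close>, its form at a vector depends only on the part orthogonal to \<open>v\<close>, where \<open>N\<close> agrees
  with \<open>M\<close>.
\<close>

lemma pos_semidef_deflate:
  assumes M: "pos_semidef M" and v: "norm v = 1" and eig: "M *v v = r *\<^sub>R v"
  defines "N \<equiv> M - r *\<^sub>R rank_one v"
  shows "pos_semidef N" "N *v v = 0"
proof -
  have herm: "hermitian N"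
    using M unfolding N_def
    by (intro hermitian_diff hermitian_scaleR hermitian_rank_one)
       (simp_all add: pos_semidef_iff_inner)
  have N: "N *v x = M *v x - r *\<^sub>R (cdot x v *s v)" for x
    by (simp add: N_def matrix_vector_mult_diff_rdistrib scaleR_matrix_vector
        rank_one_mult_vector)
  show Nv: "N *v v = 0"
    using v by (simp add: N eig cdot_self)
  have "0 \<le> (N *v x) \<bullet> x" for x
  proof -
    define c where "c = cdot x v"
    define y where "y = x - c *s v"
    have "cdot y v = cdot x v - c * cdot v v"
      by (simp add: y_def cdot_def algebra_simps sum_subtractf sum_distrib_left)
    then have "cdot y v = 0"
      using v by (simp add: c_def cdot_self)
    then have "N *v y = M *v y"
      by (simp add: N)
    have "N *v (c *s v) = c *s (N *v v)"
      by (simp add: matrix_vector_mult_def vec_eq_iff sum_distrib_left mult_ac)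
    then have "N *v x = N *v y"
      using Nv by (simp add: y_def matrix_vector_mult_diff_distrib)
    then have "(N *v x) \<bullet> x = (N *v y) \<bullet> y"
      using herm by (metis hermitian_iff_inner)
    then show ?thesis
      using M \<open>N *v y = M *v y\<close> by (simp add: pos_semidef_iff_inner)
  qed
  then show "pos_semidef N"
    using herm by (simp add: pos_semidef_iff_inner)
qed

text \<open>
  Induction on the codimension of the kernel.  Deflation by an eigenvector \<open>v\<close> with eigenvalue
  \<open>r > 0\<close> adds \<open>v\<close> to the kernel; if \<open>B\<close> is a square root of the deflated matrix, then \<open>B v = 0\<close>, so
  that the cross terms in the square of \<open>B + sqrt r (v v\<^sup>*)\<close> vanish.
\<close>

lemma pos_semidef_sqrt_exists:
  fixes M :: "complex ^ 'd ^ 'd"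
  shows "pos_semidef M \<Longrightarrow> \<exists>B. pos_semidef B \<and> B ** B = M"
proof (induction "DIM(complex ^ 'd) - dim {x. M *v x = 0}" arbitrary: M rule: less_induct)
  case (less M)
  show ?case
  proof (cases "M = 0")
    case True
    then show ?thesis
      by (intro exI[of _ 0]) (simp add: pos_semidef_iff_inner hermitian_def)
  next
    case False
    obtain v r where v: "norm v = 1" and r: "r > 0" and eig: "M *v v = r *\<^sub>R v"
      using ex_max_eigenvector[OF less.prems False] by blast
    define N where "N = M - r *\<^sub>R rank_one v"
    have N: "pos_semidef N" "N *v v = 0"
      unfolding N_def using pos_semidef_deflate[OF less.prems v eig] by auto
    have herm: "hermitian M"
      using less.prems by (simp add: pos_semidef_iff_inner)
    have "N *v x = 0" if "M *v x = 0" for x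
    proof -
      have "M *v v = complex_of_real r *s v"
        by (simp add: eig vec_eq_iff complex_eq_iff)
      then have "cdot x (complex_of_real r *s v) = 0"
        using that cdot_hermitian_swap[OF herm, of x v] by (simp add: cdot_def)
      then have "complex_of_real r * cdot x v = 0"
        by (simp add: cdot_def sum_distrib_left mult_ac)
      then have "cdot x v = 0"
        using r by simp
      then show ?thesis
        using that by (simp add: N_def matrix_vector_mult_diff_rdistrib scaleR_matrix_vector
            rank_one_mult_vector)
    qed
    moreover have "M *v v \<noteq> 0"
      using eig r v by auto
    ultimately have "{x. M *v x = 0} \<subset> {x. N *v x = 0}"
      using N(2) by auto
    moreover have sub: "subspace {x. K *v x = 0}" for K :: "complex ^ 'd ^ 'd"
      by (auto simp: subspace_def matrix_vector_right_distrib matrix_vector_scaleR)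
    ultimately have "dim {x. M *v x = 0} < dim {x. N *v x = 0}"
      by (intro dim_psubset) (simp add: sub[THEN span_eq_iff[THEN iffD2]])
    moreover have "dim {x. N *v x = 0} \<le> DIM(complex ^ 'd)"
      by (rule dim_subset_UNIV)
    ultimately obtain B where B: "pos_semidef B" "B ** B = N"
      using less.hyps[of N] N(1) by (auto simp: diff_less_mono2)
    have hermB: "hermitian B"
      using B by (simp add: pos_semidef_iff_inner)
    have "(B *v v) \<bullet> (B *v v) = (N *v v) \<bullet> v"
      using hermB by (metis B(2) hermitian_iff_inner matrix_vector_mul_assoc)
    then have Bv: "B *v v = 0"
      using N(2) by simp
    let ?C = "B + sqrt r *\<^sub>R rank_one v"
    have "?C ** ?C = N + r *\<^sub>R rank_one v"
      using B(2) v r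
      by (simp add: matrix_add_ldistrib matrix_add_mult matrix_scaleR_mult mult_rank_one[OF Bv]
          rank_one_mult[OF hermB Bv] rank_one_idem)
    then have "?C ** ?C = M"
      by (simp add: N_def)
    moreover have "0 \<le> (rank_one v *v x) \<bullet> x" for x
    proof -
      have "rank_one v *v (rank_one v *v x) = rank_one v *v x"
        by (simp add: matrix_vector_mul_assoc rank_one_idem[OF v])
      then have "(rank_one v *v x) \<bullet> x = (rank_one v *v x) \<bullet> (rank_one v *v x)"
        by (metis hermitian_iff_inner hermitian_rank_one)
      then show ?thesis
        by simp
    qed
    then have "pos_semidef ?C"
      using B(1) r by (auto simp: pos_semidef_iff_inner matrix_vector_mult_add_rdistrib
          scaleR_matrix_vector inner_add_left
          intro!: hermitian_add hermitian_scaleR hermitian_rank_one)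
    ultimately show ?thesis
      by blast
  qed
qed

text \<open>
  With \<open>D = B - C\<close> one has \<open>B D + D C = B\<^sup>2 - C\<^sup>2 = 0\<close>.  A nonzero \<open>D\<close> has an eigenvector \<open>u\<close> with
  eigenvalue \<open>l \<noteq> 0\<close>, and pairing \<open>(B D + D C) u\<close> with \<open>u\<close> shows that the forms of \<open>B\<close> and \<open>C\<close>
  sum to \<open>0\<close> at \<open>u\<close>.  Both vanish then, hence \<open>B u = C u = 0\<close> and \<open>D u = 0\<close>, which is absurd.
\<close>

lemma pos_semidef_sqrt_unique:
  assumes B: "pos_semidef B" and C: "pos_semidef C" and eq: "B ** B = C ** C"
  shows "B = C"
proof (rule ccontr)
  define D where "D = B - C"
  assume "B \<noteq> C"
  have herm: "hermitian D"
    using B C by (auto simp: D_def pos_semidef_iff_inner intro: hermitian_diff)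
  have D: "D *v x = B *v x - C *v x" for x
    by (simp add: D_def matrix_vector_mult_diff_rdistrib)
  have DD: "((D ** D) *v x) \<bullet> x = (D *v x) \<bullet> (D *v x)" for x
    using herm by (metis hermitian_iff_inner matrix_vector_mul_assoc)
  have "pos_semidef (D ** D)"
    unfolding pos_semidef_iff_inner
  proof
    show "hermitian (D ** D)"
      using herm by (metis hermitian_iff_inner matrix_vector_mul_assoc)
  qed (simp add: DD)
  moreover have "D ** D \<noteq> 0"
  proof
    assume "D ** D = 0"
    then have "(D *v x) \<bullet> (D *v x) = 0" for x
      using DD[of x] by simp
    then have "D = 0"
      by (metis inner_eq_zero_iff matrix_eq matrix_vector_mult_0)
    then show False
      using \<open>B \<noteq> C\<close> by (simp add: D_def)
  qed
  ultimately obtain v r where v: "norm v = 1" and r: "r > 0" and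
    eig: "(D ** D) *v v = r *\<^sub>R v"
    using ex_max_eigenvector by blast
  define s where "s = sqrt r"
  have s: "s > 0" "s * s = r"
    using r by (simp_all add: s_def)
  \<comment> \<open>\<open>v\<close> is an eigenvector of \<open>D\<^sup>2\<close>, and \<open>(D - s) (D + s) v = 0\<close>: either \<open>w\<close> is an eigenvector of \<open>D\<close>
    for \<open>s\<close>, or \<open>w = 0\<close> and \<open>v\<close> is one for \<open>- s\<close>\<close>
  define w where "w = D *v v + s *\<^sub>R v"
  have Dw: "D *v w = s *\<^sub>R w"
    using eig s by (simp add: w_def matrix_vector_right_distrib matrix_vector_scaleR
        matrix_vector_mul_assoc scaleR_add_right)
  obtain u l where u: "u \<noteq> 0" and l: "l \<noteq> 0" and Du: "D *v u = l *\<^sub>R u"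
  proof (cases "w = 0")
    case True
    then have "D *v v = (- s) *\<^sub>R v"
      by (simp add: w_def add_eq_0_iff)
    then show thesis
      using v s by (intro that[of v "- s"]) auto
  next
    case False
    then show thesis
      using Dw s by (intro that[of w s]) auto
  qed
  have "B *v (D *v u) + D *v (C *v u) = (B ** B) *v u - (C ** C) *v u"
    by (simp add: D matrix_vector_mult_diff_distrib flip: matrix_vector_mul_assoc)
  then have "(B *v (D *v u)) \<bullet> u + (D *v (C *v u)) \<bullet> u = 0"
    by (simp add: eq flip: inner_add_left)
  moreover have "(D *v (C *v u)) \<bullet> u = (C *v u) \<bullet> (D *v u)"
    using herm by (metis hermitian_iff_inner)
  ultimately have "l * ((B *v u) \<bullet> u + (C *v u) \<bullet> u) = 0"
    by (simp add: Du matrix_vector_scaleR algebra_simps)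
  then have "(B *v u) \<bullet> u + (C *v u) \<bullet> u = 0"
    using l by simp
  moreover have "0 \<le> (B *v u) \<bullet> u" "0 \<le> (C *v u) \<bullet> u"
    using B C by (auto simp: pos_semidef_iff_inner)
  ultimately have "(B *v u) \<bullet> u = 0" "(C *v u) \<bullet> u = 0"
    by linarith+
  then have "D *v u = 0"
    using B C by (simp add: D pos_semidef_null)
  then show False
    using Du l u by simp
qed

lemma matrix_sqrt:
  assumes "pos_semidef M"
  shows "pos_semidef (matrix_sqrt M)" "matrix_sqrt M ** matrix_sqrt M = M"
proof -
  have "\<exists>!B. pos_semidef B \<and> B ** B = M"
    using pos_semidef_sqrt_exists[OF assms] pos_semidef_sqrt_unique by blast
  from theI'[OF this] show "pos_semidef (matrix_sqrt M)" "matrix_sqrt M ** matrix_sqrt M = M"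
    unfolding matrix_sqrt_def by auto
qed

section \<open>The quadratic form of an inverse matrix\<close>

lemma matrix_inv_pos_def_mult_vector:
  "pos_def M \<Longrightarrow> M *v (matrix_inv M *v x) = x"
  by (simp add: matrix_vector_mul_assoc matrix_inv_mult invertible_if_pos_def)

text \<open>
  The form of \<open>M\<^sup>-\<^sup>1\<close> at \<open>x\<close> is the maximum over \<open>y\<close> of the left-hand side, attained at
  \<open>y = M\<^sup>-\<^sup>1 x\<close>.  The left-hand side is affine in \<open>(x, M)\<close>, so this is the joint convexity of
  \<open>(x, M) \<mapsto> x\<^sup>* M\<^sup>-\<^sup>1 x\<close> in the form in which it is used.
\<close>

lemma inverse_form_ge:
  assumes "pos_def M"
  shows "2 * (x \<bullet> y) - (M *v y) \<bullet> y \<le> x \<bullet> (matrix_inv M *v x)"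
proof -
  define z where "z = matrix_inv M *v x"
  have Mz: "M *v z = x"
    using assms by (simp add: z_def matrix_inv_pos_def_mult_vector)
  have M: "hermitian M" "0 \<le> (M *v (y - z)) \<bullet> (y - z)"
    using pos_def_imp_pos_semidef[OF assms] by (auto simp: pos_semidef_iff_inner)
  then have "(M *v y) \<bullet> z = y \<bullet> x"
    by (simp add: hermitian_iff_inner Mz)
  then show ?thesis
    using M(2)
    by (simp add: matrix_vector_mult_diff_distrib Mz inner_diff_left inner_diff_right
        inner_commute[of y x] flip: z_def)
qed

text \<open>
  A quantitative form of the monotonicity of the inverse: increasing \<open>P\<close> by \<open>Q \<le> P\<close> lowers
  \<open>x\<^sup>* P\<^sup>-\<^sup>1 x\<close> by at least half of its first-order variation \<open>y\<^sup>* Q y\<close>.  Write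
  \<open>z = (P + Q)\<^sup>-\<^sup>1 x\<close> and \<open>w = y - z\<close>, so that \<open>P w = Q z\<close>.  The decrease \<open>x\<^sup>* w\<close> is then
  \<open>z\<^sup>* Q z + w\<^sup>* P w\<close>, which dominates \<open>z\<^sup>* Q z + w\<^sup>* Q w\<close>; twice this is at least \<open>y\<^sup>* Q y\<close> because
  \<open>y = z + w\<close>.
\<close>

lemma inverse_form_drop:
  fixes P Q :: "complex ^ 'd ^ 'd" and x :: "complex ^ 'd"
  assumes P: "pos_def P" and Q: "pos_semidef Q" and le: "\<And>w. (Q *v w) \<bullet> w \<le> (P *v w) \<bullet> w"
  defines "y \<equiv> matrix_inv P *v x"
  shows "(Q *v y) \<bullet> y \<le> 2 * (x \<bullet> y - x \<bullet> (matrix_inv (P + Q) *v x))"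
proof -
  have herm: "hermitian P" "hermitian Q"
    using pos_def_imp_pos_semidef[OF P] Q by (auto simp: pos_semidef_iff_inner)
  have "pos_def (P + Q)"
    using P Q by (auto simp: pos_def_iff_inner pos_semidef_iff_inner inner_add_left
        matrix_vector_mult_add_rdistrib intro!: hermitian_add add_pos_nonneg)
  define z where "z = matrix_inv (P + Q) *v x"
  define w where "w = y - z"
  have Py: "P *v y = x"
    using P by (simp add: y_def matrix_inv_pos_def_mult_vector)
  have Pz: "P *v z + Q *v z = x"
    using \<open>pos_def (P + Q)\<close>
    by (metis z_def matrix_inv_pos_def_mult_vector matrix_vector_mult_add_rdistrib)
  then have Pw: "P *v w = Q *v z"
    using Py by (simp add: w_def matrix_vector_mult_diff_distrib algebra_simps)
  have y: "y = z + w"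
    by (simp add: w_def)
  have "x \<bullet> w = (P *v z) \<bullet> w + (P *v w) \<bullet> w"
    using Py y by (metis inner_add_left matrix_vector_right_distrib)
  also have "(P *v z) \<bullet> w = (Q *v z) \<bullet> z"
    using herm(1) Pw by (metis hermitian_iff_inner inner_commute)
  finally have drop: "x \<bullet> w = (Q *v z) \<bullet> z + (P *v w) \<bullet> w" .
  have "0 \<le> (Q *v (z - w)) \<bullet> (z - w)"
    using Q by (simp add: pos_semidef_iff_inner)
  then have "(Q *v y) \<bullet> y \<le> 2 * ((Q *v z) \<bullet> z) + 2 * ((Q *v w) \<bullet> w)"
    by (simp add: y matrix_vector_mult_diff_distrib matrix_vector_right_distrib inner_add_left
        inner_add_right inner_diff_left inner_diff_right)
  also have "\<dots> \<le> 2 * (x \<bullet> w)"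
    using le[of w] drop by simp
  also have "\<dots> = 2 * (x \<bullet> y - x \<bullet> z)"
    by (simp add: w_def inner_diff_right)
  finally show ?thesis
    by (simp add: z_def)
qed

lemma hermitian_matrix_inv:
  assumes "pos_def P"
  shows "hermitian (matrix_inv P)"
proof -
  have "hermitian P"
    using assms by (simp add: pos_def_iff_inner)
  then show ?thesis
    unfolding hermitian_iff_inner by (metis assms matrix_inv_pos_def_mult_vector)
qed

text \<open>
  Since \<open>I + t V\<^sup>-\<^sup>1 M = V\<^sup>-\<^sup>1 (V + t M)\<close>, the two resolvents are \<open>(V + t M)\<^sup>-\<^sup>1 V\<close> and its adjoint.  In
  terms of \<open>y = (V + t M)\<^sup>-\<^sup>1 x\<close> the embedding term is therefore the form of the Carleson term
  \<open>V A V\<close>.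
\<close>

lemma resolvent_form:
  fixes V M A :: "complex ^ 'd ^ 'd" and x :: "complex ^ 'd"
  assumes V: "pos_def V" and P: "pos_def (V + t *\<^sub>R M)"
  defines "y \<equiv> matrix_inv (V + t *\<^sub>R M) *v x"
  shows "cdot ((matrix_inv (mat 1 + t *\<^sub>R (matrix_inv V ** M)) ** A
           ** matrix_inv (mat 1 + t *\<^sub>R (M ** matrix_inv V))) *v x) x
         = cdot ((V ** A ** V) *v y) y"
proof -
  define P where "P = V + t *\<^sub>R M"
  define N where "N = matrix_inv P"
  have V': "matrix_inv V ** V = mat 1" "V ** matrix_inv V = mat 1"
    using V by (auto intro: matrix_inv_mult invertible_if_pos_def)
  have N: "N ** P = mat 1" "P ** N = mat 1"
    unfolding N_def using P by (auto simp: P_def intro: matrix_inv_mult invertible_if_pos_def)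
  have "mat 1 + t *\<^sub>R (matrix_inv V ** M) = matrix_inv V ** P"
    by (simp add: P_def matrix_add_ldistrib V' matrix_scaleR_mult)
  moreover have "(matrix_inv V ** P) ** (N ** V) = mat 1"
    by (metis N(2) V'(1) matrix_mul_assoc matrix_mul_lid)
  ultimately have left: "matrix_inv (mat 1 + t *\<^sub>R (matrix_inv V ** M)) = N ** V"
    by (simp add: matrix_inv_eqI)
  have "mat 1 + t *\<^sub>R (M ** matrix_inv V) = P ** matrix_inv V"
    by (simp add: P_def matrix_add_mult V' matrix_scaleR_mult)
  moreover have "(P ** matrix_inv V) ** (V ** N) = mat 1"
    by (metis N(2) V'(1) matrix_mul_assoc matrix_mul_lid)
  ultimately have right: "matrix_inv (mat 1 + t *\<^sub>R (M ** matrix_inv V)) = V ** N"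
    by (simp add: matrix_inv_eqI)
  have "hermitian N"
    unfolding N_def by (rule hermitian_matrix_inv) (use P in \<open>simp add: P_def\<close>)
  then have "cdot (N *v u) x = cdot u y" for u
    by (simp add: cdot_hermitian_swap y_def N_def P_def)
  moreover have "(N ** V ** A ** (V ** N)) *v x = N *v ((V ** A ** V) *v y)"
    by (simp add: y_def N_def P_def matrix_vector_mul_assoc matrix_mul_assoc)
  ultimately show ?thesis
    by (simp add: left right)
qed

section \<open>Averages\<close>

lemma set_integral_bounded_linear:
  assumes "bounded_linear h" "set_integrable M S F"
  shows "set_integrable M S (\<lambda>t. h (F t))" "(LINT t:S|M. h (F t)) = h (LINT t:S|M. F t)"
proof -
  interpret bounded_linear h by fact
  show "set_integrable M S (\<lambda>t. h (F t))" "(LINT t:S|M. h (F t)) = h (LINT t:S|M. F t)"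
    using integrable_bounded_linear[OF assms(1)] integral_bounded_linear[OF assms(1)] assms(2)
    by (simp_all add: set_integrable_def set_lebesgue_integral_def scaleR flip: scaleR)
qed

lemma measure_average:
  assumes "bounded_linear h" "set_integrable lebesgue S F" "measure lebesgue S > 0"
  shows "measure lebesgue S * h (average F S) = (LINT t:S|lebesgue. (h (F t) :: real))"
proof -
  interpret bounded_linear h by fact
  show ?thesis
    using assms by (simp add: average_def scaleR set_integral_bounded_linear)
qed

text \<open>
  By convention the integral of a non-integrable function is \<open>0\<close>.  The averages of \<open>W\<^sup>1\<^sup>/\<^sup>2 f\<close> are
  only used through the alternative: the function is integrable on the interval, or its average
  is \<open>0\<close>.
\<close>

lemma average_not_integrable: "\<not> set_integrable lebesgue S F \<Longrightarrow> average F S = 0"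
  by (simp add: average_def set_integrable_def set_lebesgue_integral_def
      not_integrable_integral_eq)

lemma bounded_linear_matrix_form: "bounded_linear (\<lambda>M. (M *v x) \<bullet> (y :: complex ^ 'd))"
  by (simp add: linear_iff matrix_vector_mult_add_rdistrib scaleR_matrix_vector inner_add_left
      flip: linear_conv_bounded_linear)

lemma matrix_weight_integrable:
  assumes "matrix_weight W"
  shows "set_integrable lebesgue {a..<b} W"
proof (rule set_integrable_subset)
  show "set_integrable lebesgue {a..b} W"
    using assms by (auto simp: matrix_weight_def locally_integrable_def)
qed auto

lemma average_weight_form:
  assumes "matrix_weight W" "a < b"
  shows "(b - a) * ((average W {a..<b} *v x) \<bullet> y) = (LINT t:{a..<b}|lebesgue. (W t *v x) \<bullet> y)"
  using measure_average[OF bounded_linear_matrix_form matrix_weight_integrable[OF assms(1)],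
      of a b x y] assms(2) by simp

lemma weight_form_integrable:
  assumes "matrix_weight W"
  shows "set_integrable lebesgue {a..<b} (\<lambda>t. (W t *v x) \<bullet> y)"
  by (intro set_integral_bounded_linear(1)[OF bounded_linear_matrix_form]
      matrix_weight_integrable assms)

lemma pos_def_average:
  assumes W: "matrix_weight W" and ab: "a < b"
  shows "pos_def (average W {a..<b})"
  unfolding pos_def_iff_inner
proof (intro conjI allI impI)
  have pd: "AE t in lebesgue. pos_def (W t)"
    using W by (simp add: matrix_weight_def)
  have "(LINT t:{a..<b}|lebesgue. (W t *v x) \<bullet> y) = (LINT t:{a..<b}|lebesgue. (W t *v y) \<bullet> x)"
    for x y
    unfolding set_lebesgue_integral_def
  proof (rule integral_cong_AE)
    show "AE t in lebesgue. indicat_real {a..<b} t *\<^sub>R ((W t *v x) \<bullet> y)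
        = indicat_real {a..<b} t *\<^sub>R ((W t *v y) \<bullet> x)"
      using pd
    proof eventually_elim
      case (elim t)
      then have "(W t *v x) \<bullet> y = (W t *v y) \<bullet> x"
        by (metis pos_def_iff_inner hermitian_iff_inner inner_commute)
      then show ?case
        by simp
    qed
  qed (use weight_form_integrable[OF W] in
      \<open>auto simp: set_integrable_def intro: borel_measurable_integrable\<close>)
  then have "(b - a) * ((average W {a..<b} *v x) \<bullet> y) = (b - a) * ((average W {a..<b} *v y) \<bullet> x)"
    for x y
    by (simp add: average_weight_form W ab)
  then show "hermitian (average W {a..<b})"
    using ab by (simp add: hermitian_iff_inner inner_commute)
next
  fix x :: "complex ^ 'a"
  assume x: "x \<noteq> 0"
  have pos: "AE t in lebesgue. 0 < (W t *v x) \<bullet> x"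
    using W x by (auto simp: matrix_weight_def pos_def_iff_inner)
  let ?g = "\<lambda>t. indicat_real {a..<b} t *\<^sub>R ((W t *v x) \<bullet> x)"
  have int: "integrable lebesgue ?g"
    using weight_form_integrable[OF W] by (simp add: set_integrable_def)
  have nonneg: "AE t in lebesgue. 0 \<le> ?g t"
    using pos by eventually_elim simp
  have "integral\<^sup>L lebesgue ?g \<noteq> 0"
  proof
    assume "integral\<^sup>L lebesgue ?g = 0"
    then have "AE t in lebesgue. ?g t = 0"
      using integral_nonneg_eq_0_iff_AE[OF int nonneg] by simp
    then have "AE t in lebesgue. t \<notin> {a..<b}"
      using pos by eventually_elim (auto simp: indicator_def split: if_splits)
    then have "{a..<b} \<in> null_sets lebesgue"
      by (subst (asm) AE_iff_null_sets[symmetric]) auto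
    then have "measure lebesgue {a..<b} = 0"
      by (simp add: null_sets_def measure_def)
    then show False
      using ab by simp
  qed
  then have "0 < integral\<^sup>L lebesgue ?g"
    using integral_nonneg_AE[OF nonneg] by linarith
  then have "0 < (b - a) * ((average W {a..<b} *v x) \<bullet> x)"
    by (simp add: average_weight_form W ab set_lebesgue_integral_def)
  then show "0 < (average W {a..<b} *v x) \<bullet> x"
    using ab by (simp add: zero_less_mult_iff)
qed

section \<open>Dyadic intervals\<close>

lemma dyadic_level_iff:
  "I \<in> dyadic_level \<omega> j \<longleftrightarrow>
    (\<exists>k :: int. I = {2 powi (- j) * of_int k + dyadic_shift \<omega> j ..<
      2 powi (- j) * of_int (k + 1) + dyadic_shift \<omega> j})"
proof -
  define h :: real where "h = 2 powi (- j)"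
  have "h > 0"
    by (simp add: h_def)
  have "(\<lambda>x. x + s) ` (\<lambda>x. h * (x + of_int k)) ` {0..<1} = {h * of_int k + s..<h * of_int (k + 1) + s}"
    for k :: int and s :: real
  proof -
    have "(\<lambda>x. x + s) ` (\<lambda>x. h * (x + of_int k)) ` {0..<1} = (\<lambda>x. h * x + (h * of_int k + s)) ` {0..<1}"
      by (simp add: image_image algebra_simps)
    also have "\<dots> = {h * of_int k + s..<h * of_int (k + 1) + s}"
    proof (intro set_eqI iffI)
      fix y
      assume "y \<in> {h * of_int k + s..<h * of_int (k + 1) + s}"
      then show "y \<in> (\<lambda>x. h * x + (h * of_int k + s)) ` {0..<1}"
        using \<open>h > 0\<close>
        by (intro image_eqI[of _ _ "(y - (h * of_int k + s)) / h"]) (auto simp: field_simps)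
    qed (use \<open>h > 0\<close> in \<open>auto simp: algebra_simps\<close>)
    finally show ?thesis .
  qed
  then show ?thesis
    unfolding dyadic_level_def std_dyadic_def h_def by (auto simp: image_iff)
qed

lemma dyadic_level_disjoint:
  assumes "I \<in> dyadic_level \<omega> j" "J \<in> dyadic_level \<omega> j" "p \<in> I" "p \<in> J"
  shows "I = J"
proof -
  define h :: real where "h = 2 powi (- j)"
  have "h > 0"
    by (simp add: h_def)
  define s where "s = dyadic_shift \<omega> j"
  obtain k l :: int where I: "I = {h * of_int k + s..<h * of_int (k + 1) + s}"
    and J: "J = {h * of_int l + s..<h * of_int (l + 1) + s}"
    using assms(1,2) unfolding dyadic_level_iff h_def s_def by blast
  have "h * of_int k < h * of_int (l + 1)" "h * of_int l < h * of_int (k + 1)"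
    using assms(3,4) unfolding I J by auto
  then have "k < l + 1" "l < k + 1"
    using \<open>h > 0\<close> by (metis mult_less_cancel_left_pos of_int_less_iff)+
  then show ?thesis
    by (simp add: I J)
qed

lemma dyadic_shift_step:
  assumes "range \<omega> \<subseteq> {0, 1}"
  shows "dyadic_shift \<omega> j = dyadic_shift \<omega> (j + 1) + 2 powi (- (j + 1)) * real (\<omega> (j + 1))"
proof -
  define g where "g i = 2 powi (- i) * real (\<omega> i)" for i
  have "bij_betw (\<lambda>n. j + 2 + int n) UNIV {j + 1<..}"
    by (rule bij_betwI[where g = "\<lambda>i. nat (i - (j + 2))"]) auto
  moreover have "(\<lambda>n. g (j + 2 + int n)) summable_on UNIV"
  proof (rule norm_summable_imp_summable_on, rule summable_comparison_test')
    show "summable (\<lambda>n. 2 powi (- (j + 2)) * (1 / 2 :: real) ^ n)"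
      by (intro summable_mult summable_geometric) simp
    show "norm (norm (g (j + 2 + int n))) \<le> 2 powi (- (j + 2)) * (1 / 2) ^ n" if "n \<ge> 0" for n
    proof -
      have "\<omega> (j + 2 + int n) \<le> 1"
        using assms by (metis insert_iff le_numeral_extra(4) less_one linorder_not_less
            order_less_imp_le rangeI singletonD subsetD zero_le_one)
      moreover have "2 powi (- (j + 2 + int n)) = 2 powi (- (j + 2)) * (1 / 2 :: real) ^ n"
        by (simp add: power_int_diff power_int_minus power_int_add power_one_over field_simps)
      ultimately show ?thesis
        by (simp add: g_def mult_left_le)
    qed
  qed
  ultimately have "g summable_on {j + 1<..}"
    using summable_on_reindex_bij_betw by blast
  then have "infsum g (insert (j + 1) {j + 1<..}) = g (j + 1) + infsum g {j + 1<..}"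
    by (intro infsum_insert) auto
  moreover have "insert (j + 1) {j + 1<..} = {j<..}"
    by auto
  ultimately show ?thesis
    by (simp add: dyadic_shift_def g_def[abs_def])
qed

text \<open>
  The shifts of consecutive levels differ by \<open>0\<close> or by one length of the finer level, so the grid
  of the finer level refines that of the coarser one.
\<close>

lemma dyadic_halves:
  assumes "range \<omega> \<subseteq> {0, 1}" "I \<in> dyadic_level \<omega> j"
  obtains a m b where "a < m" "m < b" "I = {a..<b}"
    "{a..<m} \<in> dyadic_level \<omega> (j + 1)" "{m..<b} \<in> dyadic_level \<omega> (j + 1)"
proof -
  define h :: real where "h = 2 powi (- (j + 1))"
  have h: "h > 0" "2 powi (- j) = 2 * h"
    by (simp_all add: h_def power_int_diff power_int_minus power_int_add field_simps)
  define s where "s = dyadic_shift \<omega> (j + 1)"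
  obtain k :: int where k: "I = {2 powi (- j) * of_int k + dyadic_shift \<omega> j ..<
      2 powi (- j) * of_int (k + 1) + dyadic_shift \<omega> j}"
    using assms(2) by (auto simp: dyadic_level_iff)
  \<comment> \<open>in units of the finer level, the \<open>k\<close>-th interval starts at \<open>2 k\<close> plus the digit of the shift\<close>
  define l where "l = 2 * k + int (\<omega> (j + 1))"
  have I: "I = {h * of_int l + s..<h * of_int (l + 2) + s}"
    unfolding k dyadic_shift_step[OF assms(1), of j] h(2) l_def s_def[symmetric] h_def[symmetric]
    by (simp add: algebra_simps)
  show thesis
  proof
    show "{h * of_int l + s..<h * of_int (l + 1) + s} \<in> dyadic_level \<omega> (j + 1)"
      unfolding dyadic_level_iff h_def s_def by blast
    show "{h * of_int (l + 1) + s..<h * of_int (l + 2) + s} \<in> dyadic_level \<omega> (j + 1)"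
      unfolding dyadic_level_iff h_def s_def by (rule exI[of _ "l + 1"]) (simp add: add.assoc)
  qed (use h I in auto)
qed

section \<open>The Bellman function along the dyadic tree\<close>

locale carleson_embedding =
  fixes \<omega> :: "int \<Rightarrow> nat"
    and W :: "real \<Rightarrow> complex ^ 'd ^ 'd"
    and A :: "real set \<Rightarrow> complex ^ 'd ^ 'd"
    and t :: real
    and f :: "real \<Rightarrow> complex ^ 'd"
  assumes omega: "range \<omega> \<subseteq> {0, 1}"
    and weight: "matrix_weight W"
    and A: "\<And>I. I \<in> dyadic_of \<omega> \<Longrightarrow> pos_def (A I)"
    and carleson: "carleson_condition (dyadic_of \<omega>) W A"
    and t: "0 < t" "t \<le> 1"
    and L2: "in_L2 f"
begin

abbreviation D where "D \<equiv> dyadic_of \<omega>"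
abbreviation V where "V I \<equiv> average W I"
abbreviation T where "T I \<equiv> carleson_term W A I"
abbreviation M' where "M' I \<equiv> M_tilde D W A I"
abbreviation x where "x I \<equiv> average (\<lambda>s. matrix_sqrt (W s) *v f s) I"

text \<open>
  The counterpart of \<open>M_tilde\<close> in which the interval itself is included in the sum; the Carleson
  condition is \<open>M I \<le> V I\<close>.
\<close>

definition M :: "real set \<Rightarrow> complex ^ 'd ^ 'd" where
  "M I = (1 / measure lebesgue I) *\<^sub>R (\<Sum>\<^sub>\<infinity>J\<in>{J \<in> D. J \<subseteq> I}. T J)"

definition bellman :: "real set \<Rightarrow> real" where
  "bellman I = x I \<bullet> (matrix_inv (V I + t *\<^sub>R M I) *v x I)"

lemma dyadic_interval:
  assumes "I \<in> D"
  obtains a b where "a < b" "I = {a..<b}"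
proof -
  obtain j where "I \<in> dyadic_level \<omega> j"
    using assms by (auto simp: dyadic_of_def)
  then show thesis
    by (rule dyadic_halves[OF omega]) (meson less_trans that)
qed

lemma measure_pos: "I \<in> D \<Longrightarrow> 0 < measure lebesgue I"
  by (erule dyadic_interval) simp

lemma dyadic_measurable: "I \<in> D \<Longrightarrow> I \<in> sets lebesgue"
  by (erule dyadic_interval) simp

lemma norm_sq_integrable: "S \<in> sets lebesgue \<Longrightarrow> set_integrable lebesgue S (\<lambda>s. (norm (f s))\<^sup>2)"
  using L2 unfolding set_integrable_def in_L2_def by (intro integrable_mult_indicator) auto

lemma pos_def_V: "I \<in> D \<Longrightarrow> pos_def (V I)"
  by (erule dyadic_interval) (simp add: pos_def_average weight)

lemma pos_semidef_T: "I \<in> D \<Longrightarrow> pos_semidef (T I)"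
proof -
  assume I: "I \<in> D"
  have V: "(V I *v u) \<bullet> v = u \<bullet> (V I *v v)" for u v
    using pos_def_V[OF I] by (auto simp: pos_def_iff_inner hermitian_iff_inner)
  have AI: "(A I *v u) \<bullet> v = u \<bullet> (A I *v v)" "0 \<le> (A I *v u) \<bullet> u" for u v
    using pos_def_imp_pos_semidef[OF A[OF I]]
    by (auto simp: pos_semidef_iff_inner hermitian_iff_inner)
  have T: "T I *v u = V I *v (A I *v (V I *v u))" for u
    by (simp add: carleson_term_def matrix_vector_mul_assoc matrix_mul_assoc)
  have "0 \<le> (T I *v u) \<bullet> u" for u
    using AI(2)[of "V I *v u"] by (simp add: T V)
  moreover have "hermitian (T I)"
    by (simp add: hermitian_iff_inner T V AI(1))
  ultimately show "pos_semidef (T I)"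
    by (simp add: pos_semidef_iff_inner)
qed

lemma T_form_nonneg: "I \<in> D \<Longrightarrow> 0 \<le> (T I *v y) \<bullet> y"
  using pos_semidef_T by (simp add: pos_semidef_iff_inner)

lemma summable_T: "I \<in> D \<Longrightarrow> S \<subseteq> {J \<in> D. J \<subseteq> I} \<Longrightarrow> T summable_on S"
  using carleson summable_on_subset_banach unfolding carleson_condition_def by blast

lemma form_infsum_T:
  assumes "I \<in> D" "S \<subseteq> {J \<in> D. J \<subseteq> I}"
  shows "(\<lambda>J. (T J *v y) \<bullet> y) summable_on S"
    "(infsum T S *v y) \<bullet> y = (\<Sum>\<^sub>\<infinity>J\<in>S. (T J *v y) \<bullet> y)"
proof -
  have "((\<lambda>J. (T J *v y) \<bullet> y) has_sum ((infsum T S *v y) \<bullet> y)) S"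
    using has_sum_bounded_linear[OF bounded_linear_matrix_form
        has_sum_infsum[OF summable_T[OF assms]]] by (simp add: o_def)
  then show "(\<lambda>J. (T J *v y) \<bullet> y) summable_on S"
    "(infsum T S *v y) \<bullet> y = (\<Sum>\<^sub>\<infinity>J\<in>S. (T J *v y) \<bullet> y)"
    by (auto simp: has_sum_imp_summable infsumI)
qed

lemma M_form:
  assumes "I \<in> D"
  shows "measure lebesgue I * ((M I *v y) \<bullet> y) = (\<Sum>\<^sub>\<infinity>J\<in>{J \<in> D. J \<subseteq> I}. (T J *v y) \<bullet> y)"
  using measure_pos[OF assms] form_infsum_T(2)[OF assms subset_refl]
  by (simp add: M_def scaleR_matrix_vector)

lemma M'_form:
  assumes "I \<in> D"
  shows "measure lebesgue I * ((M' I *v y) \<bullet> y) = (\<Sum>\<^sub>\<infinity>J\<in>{J \<in> D. J \<subset> I}. (T J *v y) \<bullet> y)"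
  using measure_pos[OF assms] form_infsum_T(2)[OF assms, of "{J \<in> D. J \<subset> I}"]
  by (force simp: M_tilde_def scaleR_matrix_vector)

lemma M_eq:
  assumes "I \<in> D"
  shows "M I = M' I + (1 / measure lebesgue I) *\<^sub>R T I"
proof -
  have "{J \<in> D. J \<subseteq> I} = insert I {J \<in> D. J \<subset> I}"
    using assms by auto
  moreover have "infsum T (insert I {J \<in> D. J \<subset> I}) = T I + infsum T {J \<in> D. J \<subset> I}"
    by (intro infsum_insert summable_T[OF assms]) auto
  ultimately show ?thesis
    by (simp add: M_def M_tilde_def scaleR_add_right add.commute)
qed

lemma M_le: "I \<in> D \<Longrightarrow> loewner_le (M I) (V I)"
  using carleson by (simp add: carleson_condition_def M_def)

lemma pos_semidef_M':
  assumes "I \<in> D"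
  shows "pos_semidef (M' I)"
proof -
  have V: "hermitian (V I)"
    using pos_def_V[OF assms] by (simp add: pos_def_iff_inner)
  have VM: "hermitian (V I - M I)"
    using M_le[OF assms] by (simp add: loewner_le_iff_inner)
  have T: "hermitian (T I)"
    using pos_semidef_T[OF assms] by (simp add: pos_semidef_iff_inner)
  have "hermitian (V I - (V I - M I) - (1 / measure lebesgue I) *\<^sub>R T I)"
    by (rule hermitian_diff[OF hermitian_diff[OF V VM] hermitian_scaleR[OF T]])
  then have "hermitian (M' I)"
    by (simp add: M_eq[OF assms])
  moreover have "0 \<le> (M' I *v y) \<bullet> y" for y
  proof -
    have "0 \<le> measure lebesgue I * ((M' I *v y) \<bullet> y)"
      unfolding M'_form[OF assms] by (intro infsum_nonneg) (auto intro: T_form_nonneg)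
    then show ?thesis
      using measure_pos[OF assms] by (simp add: zero_le_mult_iff)
  qed
  ultimately show ?thesis
    by (simp add: pos_semidef_iff_inner)
qed

text \<open>
  Up to normalisation, \<open>M_tilde\<close> on \<open>I\<close> sums over all proper dyadic subintervals, among which are
  those of the two halves.  The inequality is enough, because the Bellman function decreases when
  the matrix \<open>M\<close> increases.
\<close>

lemma M'_halves:
  assumes I: "I \<in> D" and L: "L \<in> D" "L \<subset> I" and R: "R \<in> D" "R \<subset> I" and "L \<inter> R = {}"
  shows "measure lebesgue L * ((M L *v y) \<bullet> y) + measure lebesgue R * ((M R *v y) \<bullet> y)
    \<le> measure lebesgue I * ((M' I *v y) \<bullet> y)"
proof -
  let ?q = "\<lambda>J. (T J *v y) \<bullet> y"
  let ?L = "{J \<in> D. J \<subseteq> L}" and ?R = "{J \<in> D. J \<subseteq> R}"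
  have "J \<noteq> {}" if "J \<in> D" for J
    using that by (auto elim: dyadic_interval)
  then have disj: "?L \<inter> ?R = {}"
    using \<open>L \<inter> R = {}\<close> by blast
  have "infsum ?q ?L + infsum ?q ?R = infsum ?q (?L \<union> ?R)"
    using form_infsum_T(1)[OF L(1) subset_refl] form_infsum_T(1)[OF R(1) subset_refl] disj
    by (simp add: infsum_Un_disjoint)
  also have "\<dots> \<le> infsum ?q {J \<in> D. J \<subset> I}"
  proof (rule infsum_mono2)
    show "?q summable_on ?L \<union> ?R" "?q summable_on {J \<in> D. J \<subset> I}"
      using L R by (auto intro!: form_infsum_T(1)[OF I])
  qed (use L R in \<open>auto intro: T_form_nonneg\<close>)
  finally show ?thesis
    by (simp add: M_form M'_form I L R)
qed

lemma pos_def_V_plus_M':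
  assumes "I \<in> D"
  shows "pos_def (V I + t *\<^sub>R M' I)"
  using pos_def_V[OF assms] pos_semidef_M'[OF assms] t
  by (auto simp: pos_def_iff_inner pos_semidef_iff_inner inner_add_left scaleR_matrix_vector
      matrix_vector_mult_add_rdistrib intro!: hermitian_add hermitian_scaleR add_pos_nonneg)

lemma V_plus_M_eq:
  "I \<in> D \<Longrightarrow> V I + t *\<^sub>R M I = (V I + t *\<^sub>R M' I) + (t / measure lebesgue I) *\<^sub>R T I"
  by (simp add: M_eq scaleR_add_right)

lemma pos_semidef_jump: "I \<in> D \<Longrightarrow> pos_semidef ((t / measure lebesgue I) *\<^sub>R T I)"
  using pos_semidef_T[of I] t
  by (auto simp: pos_semidef_iff_inner scaleR_matrix_vector intro!: hermitian_scaleR)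

lemma pos_def_V_plus_M:
  assumes "I \<in> D"
  shows "pos_def (V I + t *\<^sub>R M I)"
  using pos_def_V_plus_M'[OF assms] pos_semidef_jump[OF assms]
  unfolding V_plus_M_eq[OF assms] pos_def_iff_inner pos_semidef_iff_inner
    matrix_vector_mult_add_rdistrib[of "V I + t *\<^sub>R M' I"] inner_add_left[of "(V I + _) *v _"]
  by (auto intro!: hermitian_add add_pos_nonneg)

text \<open>
  This is where the Carleson condition and \<open>t \<le> 1\<close> enter:
  \<open>t (M - M_tilde) \<le> t M \<le> t V \<le> V\<close>.  It provides the bound \<open>Q \<le> P\<close> of \<open>inverse_form_drop\<close>.
\<close>

lemma jump_le:
  assumes "I \<in> D"
  shows "(((t / measure lebesgue I) *\<^sub>R T I) *v y) \<bullet> y \<le> ((V I + t *\<^sub>R M' I) *v y) \<bullet> y"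
proof -
  have T: "((1 / measure lebesgue I) *\<^sub>R T I *v y) \<bullet> y = (M I *v y) \<bullet> y - (M' I *v y) \<bullet> y"
    by (simp add: M_eq[OF assms] matrix_vector_mult_add_rdistrib inner_add_left)
  have MV: "(M I *v y) \<bullet> y \<le> (V I *v y) \<bullet> y" and M': "0 \<le> (M' I *v y) \<bullet> y"
    using M_le[OF assms] pos_semidef_M'[OF assms]
    by (auto simp: loewner_le_iff_inner pos_semidef_iff_inner)
  have "0 \<le> (V I *v y) \<bullet> y"
    using pos_def_imp_pos_semidef[OF pos_def_V[OF assms]] by (simp add: pos_semidef_iff_inner)
  then have "t * ((V I *v y) \<bullet> y) \<le> (V I *v y) \<bullet> y"
    using t by (simp add: mult_left_le_one_le)
  moreover have "t * ((M I *v y) \<bullet> y) \<le> t * ((V I *v y) \<bullet> y)"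
    using t MV by simp
  moreover have "0 \<le> t * ((M' I *v y) \<bullet> y)"
    using t M' by simp
  ultimately have "t * ((M I *v y) \<bullet> y - (M' I *v y) \<bullet> y) \<le> (V I *v y) \<bullet> y + t * ((M' I *v y) \<bullet> y)"
    by (simp add: algebra_simps)
  then show ?thesis
    unfolding T[symmetric]
    by (simp add: scaleR_matrix_vector matrix_vector_mult_add_rdistrib inner_add_left)
qed

lemma bellman_nonneg:
  assumes "I \<in> D"
  shows "0 \<le> bellman I"
  using inverse_form_ge[OF pos_def_V_plus_M[OF assms], of "x I" 0] by (simp add: bellman_def)

text \<open>
  The case \<open>P = V + t M_tilde\<close>, \<open>Q = t V A V / |I|\<close> of \<open>inverse_form_drop\<close>: the left-hand side is \<open>t\<close> times
  the embedding term, by \<open>resolvent_form\<close>.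
\<close>

lemma bellman_drop:
  assumes "I \<in> D"
  defines "y \<equiv> matrix_inv (V I + t *\<^sub>R M' I) *v x I"
  shows "t * ((T I *v y) \<bullet> y) \<le> 2 * measure lebesgue I * (x I \<bullet> y - bellman I)"
proof -
  have "(((t / measure lebesgue I) *\<^sub>R T I) *v y) \<bullet> y \<le> 2 * (x I \<bullet> y - bellman I)"
    unfolding y_def bellman_def V_plus_M_eq[OF assms(1)]
    by (intro inverse_form_drop pos_def_V_plus_M' pos_semidef_jump jump_le assms)
  then have "measure lebesgue I * ((((t / measure lebesgue I) *\<^sub>R T I) *v y) \<bullet> y)
      \<le> measure lebesgue I * (2 * (x I \<bullet> y - bellman I))"
    by (intro mult_left_mono) auto
  then show ?thesis
    using measure_pos[OF assms(1)] by (simp add: scaleR_matrix_vector algebra_simps)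
qed

text \<open>
  Joint convexity: the vector \<open>y\<close> that is optimal on \<open>I\<close> is a competitor on both halves, and the
  averages on \<open>I\<close> are the weighted means of those on the halves.  If \<open>W\<^sup>1\<^sup>/\<^sup>2 f\<close> is not integrable
  on \<open>I\<close>, the left-hand side is \<open>0\<close> and positivity of the Bellman function suffices.
\<close>

lemma bellman_halves:
  assumes ab: "a < m" "m < b" "{a..<b} \<in> D" "{a..<m} \<in> D" "{m..<b} \<in> D"
  defines "I \<equiv> {a..<b}" and "L \<equiv> {a..<m}" and "R \<equiv> {m..<b}"
  defines "y \<equiv> matrix_inv (V I + t *\<^sub>R M' I) *v x I"
  shows "measure lebesgue I * (x I \<bullet> y)
    \<le> measure lebesgue L * bellman L + measure lebesgue R * bellman R"
proof (cases "set_integrable lebesgue I (\<lambda>s. matrix_sqrt (W s) *v f s)")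
  case False
  then have "x I = 0"
    by (rule average_not_integrable)
  moreover have "0 \<le> measure lebesgue L * bellman L" "0 \<le> measure lebesgue R * bellman R"
    using ab bellman_nonneg by (simp_all add: L_def R_def)
  ultimately show ?thesis
    by simp
next
  case True
  have "a \<in> I - R" "m \<in> I - L"
    using ab by (auto simp: I_def L_def R_def)
  moreover have "L \<inter> R = {}" "I = L \<union> R"
    using ab by (auto simp: I_def L_def R_def)
  ultimately have LR: "L \<subset> I" "R \<subset> I" "L \<inter> R = {}" "I = L \<union> R"
    by auto
  have dyadic: "I \<in> D" "L \<in> D" "R \<in> D"
    using ab by (simp_all add: I_def L_def R_def)
  have meas: "L \<in> sets lebesgue" "R \<in> sets lebesgue"
    by (simp_all add: L_def R_def)
  have split: "measure lebesgue I * h (average F I)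
      = measure lebesgue L * h (average F L) + measure lebesgue R * h (average F R)"
    if "bounded_linear h" "set_integrable lebesgue I F"
    for F :: "real \<Rightarrow> 'e::{banach, second_countable_topology}" and h :: "'e \<Rightarrow> real"
  proof -
    have int: "set_integrable lebesgue L F" "set_integrable lebesgue R F"
      using that(2) LR meas by (auto intro: set_integrable_subset)
    have "(LINT s:I|lebesgue. h (F s)) = (LINT s:L|lebesgue. h (F s)) + (LINT s:R|lebesgue. h (F s))"
      unfolding LR(4)
      by (intro set_integral_Un LR set_integral_bounded_linear(1)[OF that(1)] int)
    then show ?thesis
      using measure_average[OF that] measure_average[OF that(1)] int dyadic measure_pos by simp
  qed
  let ?l = "measure lebesgue L" and ?r = "measure lebesgue R" and ?i = "measure lebesgue I"
  have x: "?i * (x I \<bullet> y) = ?l * (x L \<bullet> y) + ?r * (x R \<bullet> y)"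
    by (rule split[OF bounded_linear_inner_left True])
  have V: "?i * ((V I *v y) \<bullet> y) = ?l * ((V L *v y) \<bullet> y) + ?r * ((V R *v y) \<bullet> y)"
    by (rule split[OF bounded_linear_matrix_form])
       (simp add: I_def matrix_weight_integrable weight)
  have M: "?l * ((M L *v y) \<bullet> y) + ?r * ((M R *v y) \<bullet> y) \<le> ?i * ((M' I *v y) \<bullet> y)"
    using LR dyadic by (intro M'_halves)
  have half: "measure lebesgue J * (2 * (x J \<bullet> y) - (V J *v y) \<bullet> y - t * ((M J *v y) \<bullet> y))
      \<le> measure lebesgue J * bellman J" if "J \<in> D" for J
    using inverse_form_ge[OF pos_def_V_plus_M[OF that], of "x J" y]
    by (intro mult_left_mono)
       (simp_all add: bellman_def matrix_vector_mult_add_rdistrib scaleR_matrix_vector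
        inner_add_left algebra_simps)
  have optimal: "(V I *v y) \<bullet> y + t * ((M' I *v y) \<bullet> y) = x I \<bullet> y"
    using matrix_inv_pos_def_mult_vector[OF pos_def_V_plus_M'[OF dyadic(1)], of "x I"]
    by (simp add: matrix_vector_mult_add_rdistrib scaleR_matrix_vector flip: y_def inner_add_left
        inner_scaleR_left)
  have "?i * (x I \<bullet> y) = 2 * (?i * (x I \<bullet> y)) - ?i * ((V I *v y) \<bullet> y)
      - t * (?i * ((M' I *v y) \<bullet> y))"
    by (simp add: algebra_simps flip: optimal)
  also have "\<dots> \<le> 2 * (?i * (x I \<bullet> y)) - ?i * ((V I *v y) \<bullet> y)
      - t * (?l * ((M L *v y) \<bullet> y) + ?r * ((M R *v y) \<bullet> y))"
    using M t by simp
  also have "\<dots> \<le> ?l * bellman L + ?r * bellman R"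
    using half[OF dyadic(2)] half[OF dyadic(3)] unfolding x V by (simp add: algebra_simps)
  finally show ?thesis .
qed

text \<open>
  With \<open>z\<close> optimal for \<open>I\<close>, drop \<open>t M\<close> and move the average inside:
  \<open>2 \<langle>W\<^sup>1\<^sup>/\<^sup>2 f, z\<rangle> - \<langle>W z, z\<rangle> = 2 \<langle>f, W\<^sup>1\<^sup>/\<^sup>2 z\<rangle> - |W\<^sup>1\<^sup>/\<^sup>2 z|\<^sup>2 \<le> |f|\<^sup>2\<close> pointwise.
\<close>

lemma bellman_le:
  assumes "I \<in> D"
  shows "measure lebesgue I * bellman I \<le> (LINT s:I|lebesgue. (norm (f s))\<^sup>2)"
proof (cases "set_integrable lebesgue I (\<lambda>s. matrix_sqrt (W s) *v f s)")
  case False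
  then have "x I = 0"
    by (rule average_not_integrable)
  then show ?thesis
    by (simp add: bellman_def set_lebesgue_integral_def)
next
  case True
  define z where "z = matrix_inv (V I + t *\<^sub>R M I) *v x I"
  have "pos_semidef (M I)"
    using pos_semidef_M'[OF assms] pos_semidef_T[OF assms]
    by (auto simp: M_eq[OF assms] pos_semidef_iff_inner matrix_vector_mult_add_rdistrib
        scaleR_matrix_vector inner_add_left intro!: hermitian_add hermitian_scaleR)
  then have "0 \<le> t * ((M I *v z) \<bullet> z)"
    using t by (simp add: pos_semidef_iff_inner)
  moreover have "(V I *v z) \<bullet> z + t * ((M I *v z) \<bullet> z) = x I \<bullet> z"
    using matrix_inv_pos_def_mult_vector[OF pos_def_V_plus_M[OF assms], of "x I"]
    by (simp add: matrix_vector_mult_add_rdistrib scaleR_matrix_vector flip: z_def inner_add_left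
        inner_scaleR_left)
  ultimately have "bellman I \<le> 2 * (x I \<bullet> z) - (V I *v z) \<bullet> z"
    by (simp add: bellman_def flip: z_def)
  then have "measure lebesgue I * bellman I
      \<le> measure lebesgue I * (2 * (x I \<bullet> z) - (V I *v z) \<bullet> z)"
    by (intro mult_left_mono) auto
  also have "\<dots> = 2 * (LINT s:I|lebesgue. (matrix_sqrt (W s) *v f s) \<bullet> z)
      - (LINT s:I|lebesgue. (W s *v z) \<bullet> z)"
  proof -
    have W: "set_integrable lebesgue I W"
      using assms weight by (auto elim!: dyadic_interval intro: matrix_weight_integrable)
    show ?thesis
      using measure_average[OF bounded_linear_inner_left True measure_pos[OF assms], of z]
        measure_average[OF bounded_linear_matrix_form W measure_pos[OF assms], of z z]
      by (simp add: algebra_simps)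
  qed
  also have "\<dots> = (LINT s:I|lebesgue. 2 * ((matrix_sqrt (W s) *v f s) \<bullet> z) - (W s *v z) \<bullet> z)"
  proof -
    have "set_integrable lebesgue I (\<lambda>s. (W s *v z) \<bullet> z)"
      using assms weight by (auto elim!: dyadic_interval intro: weight_form_integrable)
    moreover have "set_integrable lebesgue I (\<lambda>s. (matrix_sqrt (W s) *v f s) \<bullet> z)"
      by (rule set_integral_bounded_linear(1)[OF bounded_linear_inner_left True])
    ultimately show ?thesis
      by (subst set_integral_diff) auto
  qed
  also have "\<dots> \<le> (LINT s:I|lebesgue. (norm (f s))\<^sup>2)"
  proof (rule set_integral_mono_AE)
    have "set_integrable lebesgue I (\<lambda>s. (W s *v z) \<bullet> z)"
      using assms weight by (auto elim!: dyadic_interval intro: weight_form_integrable)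
    moreover have "set_integrable lebesgue I (\<lambda>s. (matrix_sqrt (W s) *v f s) \<bullet> z)"
      by (rule set_integral_bounded_linear(1)[OF bounded_linear_inner_left True])
    ultimately show "set_integrable lebesgue I (\<lambda>s. 2 * ((matrix_sqrt (W s) *v f s) \<bullet> z)
        - (W s *v z) \<bullet> z)"
      by (intro set_integral_diff) auto
    show "set_integrable lebesgue I (\<lambda>s. (norm (f s))\<^sup>2)"
      by (intro norm_sq_integrable dyadic_measurable assms)
    have "AE s in lebesgue. pos_def (W s)"
      using weight by (simp add: matrix_weight_def)
    then show "AE s\<in>I in lebesgue. 2 * ((matrix_sqrt (W s) *v f s) \<bullet> z) - (W s *v z) \<bullet> z
        \<le> (norm (f s))\<^sup>2"
    proof eventually_elim
      case (elim s)
      let ?B = "matrix_sqrt (W s)"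
      have sym: "(?B *v u) \<bullet> v = u \<bullet> (?B *v v)" for u v
        using matrix_sqrt(1)[OF pos_def_imp_pos_semidef[OF elim]]
        by (auto simp: pos_semidef_iff_inner hermitian_iff_inner)
      have "(W s *v z) \<bullet> z = (?B *v (?B *v z)) \<bullet> z"
        using matrix_sqrt(2)[OF pos_def_imp_pos_semidef[OF elim]]
        by (simp add: matrix_vector_mul_assoc)
      then have B: "(W s *v z) \<bullet> z = (?B *v z) \<bullet> (?B *v z)"
        by (simp only: sym)
      have "0 \<le> (f s - ?B *v z) \<bullet> (f s - ?B *v z)"
        by simp
      then show ?case
        by (simp add: B sym[of "f s"] inner_diff_left inner_diff_right power2_norm_eq_inner
            inner_commute[of "?B *v z" "f s"])
    qed
  qed
  finally show ?thesis .
qed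

section \<open>Summation over the dyadic system\<close>

text \<open>
  The real number behind the embedding term on \<open>I\<close>.
\<close>

definition energy :: "real set \<Rightarrow> real" where
  "energy I = (let y = matrix_inv (V I + t *\<^sub>R M' I) *v x I in (T I *v y) \<bullet> y)"

lemma energy_nonneg: "I \<in> D \<Longrightarrow> 0 \<le> energy I"
  by (simp add: energy_def Let_def T_form_nonneg)

lemma embedding_term_eq:
  assumes "I \<in> D"
  shows "embedding_term D W A t f I = complex_of_real (energy I)"
proof -
  have "hermitian (T I)"
    using pos_semidef_T[OF assms] by (simp add: pos_semidef_iff_inner)
  then show ?thesis
    using resolvent_form[OF pos_def_V pos_def_V_plus_M', OF assms assms]
    by (simp add: embedding_term_def energy_def Let_def carleson_term_def cdot_hermitian)
qed

lemma energy_step: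
  assumes "I \<in> dyadic_level \<omega> j"
  obtains L R where "L \<in> dyadic_level \<omega> (j + 1)" "R \<in> dyadic_level \<omega> (j + 1)"
    "L \<union> R = I" "L \<inter> R = {}" "L \<noteq> {}" "R \<noteq> {}"
    "t * energy I + 2 * (measure lebesgue I * bellman I)
      \<le> 2 * (measure lebesgue L * bellman L) + 2 * (measure lebesgue R * bellman R)"
proof (rule dyadic_halves[OF omega assms])
  fix a m b
  assume ab: "a < m" "m < b" "I = {a..<b}"
    and levels: "{a..<m} \<in> dyadic_level \<omega> (j + 1)" "{m..<b} \<in> dyadic_level \<omega> (j + 1)"
  have dyadic: "I \<in> D" "{a..<m} \<in> D" "{m..<b} \<in> D"
    using assms levels by (auto simp: dyadic_of_def)
  show thesis
  proof (rule that[OF levels])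
    show "t * energy I + 2 * (measure lebesgue I * bellman I)
        \<le> 2 * (measure lebesgue {a..<m} * bellman {a..<m})
          + 2 * (measure lebesgue {m..<b} * bellman {m..<b})"
      using bellman_drop[OF dyadic(1)] bellman_halves[OF ab(1,2)] dyadic
      unfolding ab(3) energy_def Let_def by (simp add: algebra_simps)
  qed (use ab in auto)
qed

text \<open>
  Replacing the intervals of \<open>G\<close> by their halves gives distinct intervals, because the intervals of
  one level are disjoint; this is why the union is recorded in the induction.
\<close>

lemma energy_step_sum:
  assumes "finite G" "G \<subseteq> dyadic_level \<omega> j"
  shows "\<exists>H. finite H \<and> H \<subseteq> dyadic_level \<omega> (j + 1) \<and> \<Union>H = \<Union>G \<and>
    (\<Sum>I\<in>G. t * energy I + 2 * (measure lebesgue I * bellman I))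
      \<le> (\<Sum>I\<in>H. 2 * (measure lebesgue I * bellman I))"
  using assms
proof (induction G rule: finite_induct)
  case empty
  then show ?case
    by (intro exI[of _ "{}"]) auto
next
  case (insert I G)
  then obtain H where H: "finite H" "H \<subseteq> dyadic_level \<omega> (j + 1)" "\<Union>H = \<Union>G"
    "(\<Sum>I\<in>G. t * energy I + 2 * (measure lebesgue I * bellman I))
      \<le> (\<Sum>I\<in>H. 2 * (measure lebesgue I * bellman I))"
    by blast
  obtain L R where LR: "L \<in> dyadic_level \<omega> (j + 1)" "R \<in> dyadic_level \<omega> (j + 1)"
    "L \<union> R = I" "L \<inter> R = {}" "L \<noteq> {}" "R \<noteq> {}" and
    step: "t * energy I + 2 * (measure lebesgue I * bellman I)
      \<le> 2 * (measure lebesgue L * bellman L) + 2 * (measure lebesgue R * bellman R)"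
    using energy_step[of I j] insert.prems by blast
  have "I \<inter> \<Union>G = {}"
    using dyadic_level_disjoint[of I \<omega> j] insert.prems insert.hyps(2) by blast
  then have "L \<notin> H" "R \<notin> H" "L \<noteq> R"
    using LR H(3) by blast+
  then have "(\<Sum>I\<in>insert L (insert R H). 2 * (measure lebesgue I * bellman I))
      = 2 * (measure lebesgue L * bellman L) + 2 * (measure lebesgue R * bellman R)
        + (\<Sum>I\<in>H. 2 * (measure lebesgue I * bellman I))"
    using H(1) by simp
  then show ?case
    using H LR step insert.hyps by (intro exI[of _ "insert L (insert R H)"]) auto
qed

text \<open>
  The telescoping sum, done level by level from the coarsest one.  A finite family of dyadic
  intervals need not be closed under taking ancestors or descendants: at each level, the halves
  generated so far and the intervals of \<open>F\<close> at that level are joined before halving again.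
\<close>

lemma energy_sum_le_bellman:
  assumes "finite F" "F \<subseteq> (\<Union>i\<in>{m..<m + int n}. dyadic_level \<omega> i)"
  shows "\<exists>G. finite G \<and> G \<subseteq> dyadic_level \<omega> (m + int n) \<and>
    (\<Sum>I\<in>F. t * energy I) \<le> (\<Sum>I\<in>G. 2 * (measure lebesgue I * bellman I))"
  using assms
proof (induction n arbitrary: F)
  case 0
  then show ?case
    by (intro exI[of _ "{}"]) auto
next
  case (Suc n)
  let ?b = "\<lambda>I. 2 * (measure lebesgue I * bellman I)"
  define E where "E = F \<inter> dyadic_level \<omega> (m + int n)"
  have "F - E \<subseteq> (\<Union>i\<in>{m..<m + int n}. dyadic_level \<omega> i)"
  proof
    fix I
    assume I: "I \<in> F - E"
    then obtain i where i: "i \<in> {m..<m + int (Suc n)}" "I \<in> dyadic_level \<omega> i"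
      using Suc.prems(2) by blast
    moreover have "i \<noteq> m + int n"
      using I i(2) by (auto simp: E_def)
    ultimately have "i \<in> {m..<m + int n}"
      by simp
    with i(2) show "I \<in> (\<Union>i\<in>{m..<m + int n}. dyadic_level \<omega> i)"
      by blast
  qed
  then obtain G where G: "finite G" "G \<subseteq> dyadic_level \<omega> (m + int n)"
    "(\<Sum>I\<in>F - E. t * energy I) \<le> (\<Sum>I\<in>G. ?b I)"
    using Suc.IH[of "F - E"] Suc.prems(1) by auto
  have GE: "finite (G \<union> E)" "G \<union> E \<subseteq> dyadic_level \<omega> (m + int n)"
    using G Suc.prems by (auto simp: E_def)
  then have D: "I \<in> D" if "I \<in> G \<union> E" for I
    using that by (auto simp: dyadic_of_def)
  obtain H where H: "finite H" "H \<subseteq> dyadic_level \<omega> (m + int n + 1)"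
    "(\<Sum>I\<in>G \<union> E. t * energy I + ?b I) \<le> (\<Sum>I\<in>H. ?b I)"
    using energy_step_sum[OF GE] by blast
  have "(\<Sum>I\<in>F. t * energy I) = (\<Sum>I\<in>F - E. t * energy I) + (\<Sum>I\<in>E. t * energy I)"
    using Suc.prems(1) by (intro sum.subset_diff) (auto simp: E_def)
  also have "\<dots> \<le> (\<Sum>I\<in>G. ?b I) + (\<Sum>I\<in>E. t * energy I)"
    using G by simp
  also have "\<dots> \<le> (\<Sum>I\<in>G \<union> E. ?b I) + (\<Sum>I\<in>G \<union> E. t * energy I)"
    using GE(1) D t bellman_nonneg energy_nonneg by (intro add_mono sum_mono2) auto
  also have "\<dots> \<le> (\<Sum>I\<in>H. ?b I)"
    using H(3) by (simp add: sum.distrib add.commute)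
  finally have "(\<Sum>I\<in>F. t * energy I) \<le> (\<Sum>I\<in>H. ?b I)" .
  moreover have "m + int (Suc n) = m + int n + 1"
    by simp
  ultimately show ?case
    using H(1,2) by metis
qed

text \<open>
  Intervals of one level are disjoint, so the local bounds by \<open>|f|\<^sup>2\<close> add up to at most
  the full integral.
\<close>

lemma bellman_sum_le:
  assumes "finite G" "G \<subseteq> dyadic_level \<omega> j"
  shows "(\<Sum>I\<in>G. measure lebesgue I * bellman I) \<le> (L2_norm f)\<^sup>2"
proof -
  have G: "I \<in> D" if "I \<in> G" for I
    using that assms(2) by (auto simp: dyadic_of_def)
  then have meas: "I \<in> sets lebesgue" if "I \<in> G" for I
    using that dyadic_measurable by blast
  have "(\<Sum>I\<in>G. measure lebesgue I * bellman I) \<le> (\<Sum>I\<in>G. LINT s:I|lebesgue. (norm (f s))\<^sup>2)"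
    using G by (intro sum_mono bellman_le)
  also have "\<dots> = (LINT s:\<Union>G|lebesgue. (norm (f s))\<^sup>2)"
  proof (rule set_integral_finite_Union[where A = "\<lambda>I. I" and I = G, unfolded image_ident, symmetric])
    show "disjoint_family_on (\<lambda>I. I) G"
      using assms(2) dyadic_level_disjoint unfolding disjoint_family_on_def by blast
  qed (use assms(1) meas norm_sq_integrable in auto)
  also have "\<dots> \<le> (LINT s|lebesgue. (norm (f s))\<^sup>2)"
    unfolding set_lebesgue_integral_def
  proof (rule integral_mono)
    have "\<Union>G \<in> sets lebesgue"
      using assms(1) meas by (intro sets.finite_Union) auto
    then show "integrable lebesgue (\<lambda>s. indicat_real (\<Union>G) s *\<^sub>R (norm (f s))\<^sup>2)"
      using norm_sq_integrable by (simp add: set_integrable_def)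
  qed (use L2 in \<open>auto simp: in_L2_def indicator_def\<close>)
  also have "\<dots> = (L2_norm f)\<^sup>2"
    by (simp add: L2_norm_def)
  finally show ?thesis .
qed

lemma energy_sum_le:
  assumes "finite F" "F \<subseteq> D"
  shows "t * (\<Sum>I\<in>F. energy I) \<le> 2 * (L2_norm f)\<^sup>2"
proof -
  have "\<forall>I\<in>F. \<exists>j. I \<in> dyadic_level \<omega> j"
    using assms(2) by (auto simp: dyadic_of_def)
  then obtain lev where lev: "\<And>I. I \<in> F \<Longrightarrow> I \<in> dyadic_level \<omega> (lev I)"
    by metis
  define m where "m = Min (insert 0 (lev ` F))"
  define n where "n = nat (Max (insert 0 (lev ` F)) - m + 1)"
  have "lev I \<in> {m..<m + int n}" if "I \<in> F" for I
  proof -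
    have "m \<le> lev I" "lev I \<le> Max (insert 0 (lev ` F))"
      using that assms(1) by (auto simp: m_def)
    then show ?thesis
      by (auto simp: n_def)
  qed
  then have "F \<subseteq> (\<Union>i\<in>{m..<m + int n}. dyadic_level \<omega> i)"
    using lev by blast
  from energy_sum_le_bellman[OF assms(1) this]
  obtain G where G: "finite G" "G \<subseteq> dyadic_level \<omega> (m + int n)"
    "(\<Sum>I\<in>F. t * energy I) \<le> (\<Sum>I\<in>G. 2 * (measure lebesgue I * bellman I))"
    by blast
  have "t * (\<Sum>I\<in>F. energy I) = (\<Sum>I\<in>F. t * energy I)"
    by (simp add: sum_distrib_left)
  also have "\<dots> \<le> 2 * (\<Sum>I\<in>G. measure lebesgue I * bellman I)"
    using G(3) by (simp add: sum_distrib_left)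
  also have "\<dots> \<le> 2 * (L2_norm f)\<^sup>2"
    using bellman_sum_le[OF G(1,2)] by simp
  finally show ?thesis .
qed

end

theorem theorem8p1:
  fixes D :: "real set set"
    and W :: "real \<Rightarrow> complex ^ 'd ^ 'd"
    and A :: "real set \<Rightarrow> complex ^ 'd ^ 'd"
    and f :: "real \<Rightarrow> complex ^ 'd"
    and t :: real
  assumes "dyadic_system D"
    and "matrix_weight W"
    and "\<And>I. I \<in> D \<Longrightarrow> pos_def (A I)"
    and "carleson_condition D W A"
    and "0 < t" and "t \<le> 1"
    and "in_L2 f"
  shows "embedding_term D W A t f summable_on D \<and>
    complex_of_real t * (\<Sum>\<^sub>\<infinity>I\<in>D. embedding_term D W A t f I)
      \<le> complex_of_real (8 * (L2_norm f)\<^sup>2)"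
proof -
  obtain \<omega> where \<omega>: "range \<omega> \<subseteq> {0, 1}" and D: "D = dyadic_of \<omega>"
    using assms(1) by (auto simp: dyadic_system_def)
  interpret carleson_embedding \<omega> W A t f
    using assms \<omega> by unfold_locales (auto simp: D)
  have bound: "sum energy F \<le> 2 * (L2_norm f)\<^sup>2 / t" if "finite F" "F \<subseteq> D" for F
    using energy_sum_le[of F] that assms(5) by (simp add: D field_simps)
  have summable: "energy summable_on D"
    by (rule nonneg_bdd_above_summable_on)
       (use bound energy_nonneg in \<open>auto simp: D intro!: bdd_aboveI\<close>)
  then have "infsum energy D \<le> 2 * (L2_norm f)\<^sup>2 / t"
    using bound by (intro infsum_le_finite_sums) auto
  then have "t * infsum energy D \<le> 8 * (L2_norm f)\<^sup>2"
    using assms(5) by (simp add: field_simps) (smt (verit) zero_le_power2)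
  moreover have "(embedding_term D W A t f has_sum complex_of_real (infsum energy D)) D"
  proof -
    have "((\<lambda>I. complex_of_real (energy I)) has_sum complex_of_real (infsum energy D)) D"
      using summable by (intro has_sum_of_real has_sum_infsum)
    then show ?thesis
      using embedding_term_eq by (subst has_sum_cong) (auto simp: D)
  qed
  ultimately show ?thesis
    by (auto simp: has_sum_imp_summable infsumI less_eq_complex_def)
qed

end
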